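(* Let $N$ be a (right) Novikov algebra over $\mathbb{Q}$. For $f\in N$ we have, as an identity of formal series (graded by the number of occurrences of $f$): $$\log_\triangleleft(f)=f+\sum_{n=2}^\infty\sum_{i=1}^{n-1}\frac{(-1)^i}{i+1}\left(\sum_{k_1+\cdots+k_i=n-1}\frac{1}{k_1!\cdots k_i!}\big(\cdots(f\{f^{\odot k_1}\})\cdots\big)\{f^{\odot k_i}\}\right),$$ where the $k_j$ are positive integers. When furthermore $N=(\mathcal A,\partial)$ is a commutative algebra with derivation (with Novikov product $a\triangleleft b=\partial(a)b$), we obtain $$\log_\triangleleft(f)=f+\sum_{n=2}^\infty\sum_{i=1}^{n-1}\frac{(-1)^i}{i+1}\left(\sum_{k_1+\cdots+k_i=n-1}\frac{1}{k_1!\cdots k_i!}f^{k_i}\partial^{k_i}\big(\cdots(f^{k_1}\partial^{k_1}(f))\cdots\big)\right).$$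
   Context: A (right) Novikov algebra is a vector space $N$ with a bilinear product $\triangleleft$ such that $(x\triangleleft y)\triangleleft z-x\triangleleft(y\triangleleft z)$ is symmetric in $y,z$ (right pre-Lie) and $a\triangleleft(b\triangleleft c)=b\triangleleft(a\triangleleft c)$. Its symmetric braces $v\{w_1\cdots w_n\}$ (symmetric in the $w_i$) are defined by $v\{1\}=v$, $v\{w\}=v\triangleleft w$ and $$v\{w_1\cdots w_n\}=(v\{w_1\cdots w_{n-1}\})\{w_n\}-\sum_{i=1}^{n-1}v\{w_1\cdots (w_i\{w_n\})\cdots w_{n-1}\}.$$ $\mathbb{Q}[N]$ is the symmetric algebra of $N$, with commutative product $\odot$ and associative product $$(w_1\odot\cdots\odot w_n)\ast(z_1\odot\cdots\odot z_m)=\sum_{I_1\sqcup\cdots\sqcup I_{n+1}=[m]}w_1\{z_{I_1}\}\odot\cdots\odot w_n\{z_{I_n}\}\odot z_{I_{n+1}}$$ (blocks may be empty, $z_I=\bigodot_{i\in I}z_i$). The pre-Lie logarithm is $\log_\triangleleft(f):=\log_\ast(\exp_\odot(f))$, where $\exp_\odot$ is the exponential series for $\odot$ and $\log_\ast$ the logarithm series for $\ast$. Convergence is not discussed: the identities are formal, i.e. one replaces $f$ by $\lambda f$ with $\lambda$ a formal central parameter and compares coefficients of each power of $\lambda$ (extending all operations $\lambda$-linearly to power series in $\lambda$). *)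

theory Defs
  imports
    "HOL-Library.Poly_Mapping"
    "HOL-Library.Multiset"
    "HOL-Library.FuncSet"
    "HOL-Combinatorics.Permutations"
    "HOL-Computational_Algebra.Formal_Power_Series"
begin

section \<open>Rational vector spaces\<close>

class rat_vector = ab_group_add +
  fixes scaleQ :: "rat \<Rightarrow> 'a \<Rightarrow> 'a"  (infixr \<open>*\<^sub>Q\<close> 75)
  assumes scaleQ_add_right: "c *\<^sub>Q (x + y) = c *\<^sub>Q x + c *\<^sub>Q y"
    and scaleQ_add_left: "(c + d) *\<^sub>Q x = c *\<^sub>Q x + d *\<^sub>Q x"
    and scaleQ_scaleQ: "c *\<^sub>Q d *\<^sub>Q x = (c * d) *\<^sub>Q x"
    and scaleQ_one: "1 *\<^sub>Q x = x"

interpretation rat_vector: vector_space "scaleQ :: rat \<Rightarrow> 'a \<Rightarrow> 'a::rat_vector"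
  by unfold_locales (fact scaleQ_add_right scaleQ_add_left scaleQ_scaleQ scaleQ_one)+

abbreviation linearQ :: "('a::rat_vector \<Rightarrow> 'b::rat_vector) \<Rightarrow> bool"
  where "linearQ \<equiv> Vector_Spaces.linear scaleQ scaleQ"

lemma linearQ_iff:
  "linearQ h \<longleftrightarrow> (\<forall>x y. h (x + y) = h x + h y) \<and> (\<forall>c x. h (c *\<^sub>Q x) = c *\<^sub>Q h x)"
  by (simp add: Vector_Spaces.linear_iff rat_vector.vector_space_axioms)

lemma poly_mapping_monomial_induct [case_names single add]:
  fixes p :: "'k \<Rightarrow>\<^sub>0 'v::ab_group_add"
  assumes single: "\<And>k c. P (Poly_Mapping.single k c)"
    and add: "\<And>p q. P p \<Longrightarrow> P q \<Longrightarrow> P (p + q)"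
  shows "P p"
proof -
  have "P (\<Sum>k\<in>K. Poly_Mapping.single k (Poly_Mapping.lookup p k))" if "finite K" for K
    using that
  proof (induction K rule: finite_induct)
    case empty
    then show ?case using single[of _ 0] by simp
  next
    case (insert k K)
    then show ?case using single add by simp
  qed
  moreover have "p = (\<Sum>k\<in>Poly_Mapping.keys p. Poly_Mapping.single k (Poly_Mapping.lookup p k))"
    by (rule poly_mapping_eqI) (auto simp: lookup_sum lookup_single when_def in_keys_iff)
  ultimately show ?thesis by (metis finite_keys)
qed

definition poly_extend :: "('k \<Rightarrow> 'a::rat_vector) \<Rightarrow> ('k \<Rightarrow>\<^sub>0 rat) \<Rightarrow> 'a"
  where "poly_extend h p = (\<Sum>k\<in>Poly_Mapping.keys p. Poly_Mapping.lookup p k *\<^sub>Q h k)"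

lemma poly_extend_single: "poly_extend h (Poly_Mapping.single k c) = c *\<^sub>Q h k"
  by (simp add: poly_extend_def)

lemma poly_extend_add: "poly_extend h (p + q) = poly_extend h p + poly_extend h q"
proof -
  let ?K = "Poly_Mapping.keys p \<union> Poly_Mapping.keys q"
  have *: "poly_extend h r = (\<Sum>k\<in>?K. Poly_Mapping.lookup r k *\<^sub>Q h k)"
    if "Poly_Mapping.keys r \<subseteq> ?K" for r
    unfolding poly_extend_def using that
    by (intro sum.mono_neutral_left) (auto simp: in_keys_iff)
  show ?thesis
    using Poly_Mapping.keys_add[of p q]
    by (simp add: * lookup_add rat_vector.scale_left_distrib sum.distrib)
qed


section \<open>Novikov algebras and symmetric braces\<close>

locale novikov_algebra =
  fixes tri :: "'a::rat_vector \<Rightarrow> 'a \<Rightarrow> 'a"  (infixl \<open>\<triangleleft>\<close> 70)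
  assumes linear_left: "linearQ (\<lambda>x. x \<triangleleft> y)"
    and linear_right: "linearQ (\<lambda>y. x \<triangleleft> y)"
    and right_pre_Lie: "(x \<triangleleft> y) \<triangleleft> z - x \<triangleleft> (y \<triangleleft> z) = (x \<triangleleft> z) \<triangleleft> y - x \<triangleleft> (z \<triangleleft> y)"
    and left_commute: "a \<triangleleft> (b \<triangleleft> c) = b \<triangleleft> (a \<triangleleft> c)"

text \<open>\<open>brace tri v [w\<^sub>1, \<dots>, w\<^sub>n]\<close> is \<open>v{w\<^sub>1 \<cdots> w\<^sub>n}\<close>; the recursion splits off the last entry.\<close>

function brace :: "('a::ab_group_add \<Rightarrow> 'a \<Rightarrow> 'a) \<Rightarrow> 'a \<Rightarrow> 'a list \<Rightarrow> 'a"
  where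
    "brace tri v [] = v"
  | "brace tri v (ws @ [w]) =
       tri (brace tri v ws) w - (\<Sum>i<length ws. brace tri v (ws[i := tri (ws ! i) w]))"
proof -
  fix P :: bool and x :: "('a \<Rightarrow> 'a \<Rightarrow> 'a) \<times> 'a \<times> 'a list"
  assume "\<And>tri v. x = (tri, v, []) \<Longrightarrow> P" and "\<And>tri v ws w. x = (tri, v, ws @ [w]) \<Longrightarrow> P"
  then show P by (metis prod_cases3 rev_exhaust)
qed auto
termination by (relation "measure (\<lambda>(tri, v, ws). length ws)") auto


section \<open>The symmetric algebra\<close>

text \<open>
  The symmetric algebra of \<open>N\<close> is the polynomial ring over \<open>\<rat>\<close> with one generator for every element
  of \<open>N\<close> (the monoid algebra of the free commutative monoid of multisets on \<open>N\<close>), divided by the ideal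
  that makes the inclusion of \<open>N\<close> linear.
\<close>

lemma module_times: "module ((*) :: 'r \<Rightarrow> 'r \<Rightarrow> 'r::comm_ring_1)"
  by unfold_locales (simp_all add: algebra_simps)

definition sym_relators :: "('a::rat_vector multiset \<Rightarrow>\<^sub>0 rat) set"
  where "sym_relators =
    {Poly_Mapping.single {#x + y#} 1 - Poly_Mapping.single {#x#} 1 - Poly_Mapping.single {#y#} 1 | x y. True}
    \<union> {Poly_Mapping.single {#c *\<^sub>Q x#} 1 - Poly_Mapping.single {#x#} c | c x. True}"

definition sym_ideal :: "('a::rat_vector multiset \<Rightarrow>\<^sub>0 rat) set"
  where "sym_ideal = module.span (*) sym_relators"

definition sym_rel :: "('a::rat_vector multiset \<Rightarrow>\<^sub>0 rat) \<Rightarrow> ('a multiset \<Rightarrow>\<^sub>0 rat) \<Rightarrow> bool"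
  where "sym_rel p q \<longleftrightarrow> p - q \<in> sym_ideal"

lemma sym_ideal_0: "0 \<in> sym_ideal"
  and sym_ideal_add: "p \<in> sym_ideal \<Longrightarrow> q \<in> sym_ideal \<Longrightarrow> p + q \<in> sym_ideal"
  and sym_ideal_diff: "p \<in> sym_ideal \<Longrightarrow> q \<in> sym_ideal \<Longrightarrow> p - q \<in> sym_ideal"
  and sym_ideal_uminus: "p \<in> sym_ideal \<Longrightarrow> - p \<in> sym_ideal"
  and sym_ideal_mult: "p \<in> sym_ideal \<Longrightarrow> r * p \<in> sym_ideal"
  unfolding sym_ideal_def
  by (simp_all add: module.span_zero module.span_add module.span_diff module.span_neg
      module.span_scale module_times)

lemma equivp_sym_rel: "equivp sym_rel"
proof (rule equivpI)
  show "reflp sym_rel" by (simp add: reflp_def sym_rel_def sym_ideal_0)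
  show "symp sym_rel" unfolding symp_def sym_rel_def using sym_ideal_uminus by fastforce
  show "transp sym_rel" unfolding transp_def sym_rel_def using sym_ideal_add by fastforce
qed

lemma sym_rel_eqI: "p = q \<Longrightarrow> sym_rel p q"
  by (simp add: sym_rel_def sym_ideal_0)

lemma sym_ideal_induct [consumes 1, case_names zero add add_rel scale_rel]:
  assumes p: "p \<in> sym_ideal"
    and "P 0" and add: "\<And>p q. P p \<Longrightarrow> P q \<Longrightarrow> P (p + q)"
    and r1: "\<And>M c x y. P (Poly_Mapping.single (add_mset (x + y) M) c
      - Poly_Mapping.single (add_mset x M) c - Poly_Mapping.single (add_mset y M) c)"
    and r2: "\<And>M c d x. P (Poly_Mapping.single (add_mset (d *\<^sub>Q x) M) c
      - Poly_Mapping.single (add_mset x M) (d * c))"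
  shows "P p"
  using p[unfolded sym_ideal_def]
proof (induction rule: module.span_induct_alt[OF module_times, consumes 1, case_names base step])
  case base
  then show ?case by fact
next
  case (step r g p)
  have "P (r * g)"
  proof (induction r rule: poly_mapping_monomial_induct)
    case (single M c)
    from step(1) show ?case
      using r1[of _ _ M c] r2[of _ _ M c]
      by (auto simp: sym_relators_def right_diff_distrib mult_single mult.commute)
  next
    case (add p q)
    then show ?case using assms(3) by (simp add: distrib_right)
  qed
  then show ?case using step(2) add by blast
qed

lemma one_notin_sym_ideal: "1 \<notin> sym_ideal"
proof
  assume "(1 :: 'a multiset \<Rightarrow>\<^sub>0 rat) \<in> sym_ideal"
  have "Poly_Mapping.lookup p {#} = 0" if "p \<in> sym_ideal" for p :: "'a multiset \<Rightarrow>\<^sub>0 rat"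
    using that by (induction rule: sym_ideal_induct) (simp_all add: lookup_add lookup_minus lookup_single_not_eq)
  from this[of 1] show False
    using \<open>1 \<in> sym_ideal\<close> by (simp add: lookup_one zero_multiset_def [symmetric])
qed

quotient_type (overloaded) 'a sym = "'a::rat_vector multiset \<Rightarrow>\<^sub>0 rat" / sym_rel
  by (fact equivp_sym_rel)

instantiation sym :: (rat_vector) comm_ring_1
begin

lift_definition zero_sym :: "'a sym" is 0 .
lift_definition one_sym :: "'a sym" is 1 .

lift_definition plus_sym :: "'a sym \<Rightarrow> 'a sym \<Rightarrow> 'a sym" is "(+)"
  unfolding sym_rel_def by (simp only: add_diff_add sym_ideal_add)

lift_definition uminus_sym :: "'a sym \<Rightarrow> 'a sym" is uminus
  unfolding sym_rel_def by (simp only: minus_diff_minus sym_ideal_uminus)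

lift_definition minus_sym :: "'a sym \<Rightarrow> 'a sym \<Rightarrow> 'a sym" is "(-)"
proof -
  fix p p' q q' :: "'a multiset \<Rightarrow>\<^sub>0 rat"
  assume "sym_rel p p'" "sym_rel q q'"
  moreover have "p - q - (p' - q') = (p - p') - (q - q')" by simp
  ultimately show "sym_rel (p - q) (p' - q')"
    unfolding sym_rel_def by (simp only: sym_ideal_diff)
qed

lift_definition times_sym :: "'a sym \<Rightarrow> 'a sym \<Rightarrow> 'a sym" is "(*)"
proof -
  fix p p' q q' :: "'a multiset \<Rightarrow>\<^sub>0 rat"
  assume "sym_rel p p'" "sym_rel q q'"
  moreover have "p * q - p' * q' = q * (p - p') + p' * (q - q')"
    by (simp add: algebra_simps)
  ultimately show "sym_rel (p * q) (p' * q')"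
    unfolding sym_rel_def by (simp add: sym_ideal_add sym_ideal_mult)
qed

instance
proof
  show "(0 :: 'a sym) \<noteq> 1"
  proof (transfer, rule notI)
    assume "sym_rel (0 :: 'a multiset \<Rightarrow>\<^sub>0 rat) 1"
    then have "- (0 - 1) \<in> (sym_ideal :: ('a multiset \<Rightarrow>\<^sub>0 rat) set)"
      unfolding sym_rel_def by (rule sym_ideal_uminus)
    then show False by (simp add: one_notin_sym_ideal)
  qed
next
  fix x y z :: "'a sym"
  show "x + y + z = x + (y + z)" by (transfer, rule sym_rel_eqI, rule add.assoc)
  show "x + y = y + x" by (transfer, rule sym_rel_eqI, rule add.commute)
  show "0 + x = x" by (transfer, rule sym_rel_eqI, rule add_0)
  show "- x + x = 0" by (transfer, rule sym_rel_eqI, rule left_minus)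
  show "x - y = x + - y" by (transfer, rule sym_rel_eqI, rule diff_conv_add_uminus)
  show "x * y * z = x * (y * z)" by (transfer, rule sym_rel_eqI, rule mult.assoc)
  show "x * y = y * x" by (transfer, rule sym_rel_eqI, rule mult.commute)
  show "1 * x = x" by (transfer, rule sym_rel_eqI, rule mult_1)
  show "(x + y) * z = x * z + y * z" by (transfer, rule sym_rel_eqI, rule distrib_right)
qed

end

instantiation sym :: (rat_vector) rat_vector
begin

lift_definition scaleQ_sym :: "rat \<Rightarrow> 'a sym \<Rightarrow> 'a sym" is "\<lambda>c p. Poly_Mapping.single 0 c * p"
  unfolding sym_rel_def by (simp only: right_diff_distrib [symmetric] sym_ideal_mult)

instance
proof
  fix c d :: rat and x y :: "'a sym"
  show "c *\<^sub>Q (x + y) = c *\<^sub>Q x + c *\<^sub>Q y"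
    by (transfer, rule sym_rel_eqI, simp add: algebra_simps)
  show "(c + d) *\<^sub>Q x = c *\<^sub>Q x + d *\<^sub>Q x"
    by (transfer, rule sym_rel_eqI, simp add: algebra_simps single_add)
  show "c *\<^sub>Q d *\<^sub>Q x = (c * d) *\<^sub>Q x"
    by (transfer, rule sym_rel_eqI, simp add: mult.assoc[symmetric] mult_single)
  show "1 *\<^sub>Q x = x"
    by (transfer, rule sym_rel_eqI, simp)
qed

end

lift_definition sym_of :: "'a::rat_vector \<Rightarrow> 'a sym" is "\<lambda>v. Poly_Mapping.single {#v#} 1" .


section \<open>The product \<open>\<ast>\<close>\<close>

text \<open>
  A decomposition \<open>I\<^sub>1 \<squnion> \<dots> \<squnion> I\<^sub>n\<^sub>+\<^sub>1\<close> of the set of positions of \<open>zs\<close> is encoded by the function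
  \<open>\<phi>\<close> sending each position to the index of its block; indices start at \<open>0\<close>, so the
  last block, which is not inserted into any brace, is the fibre over \<open>length ws\<close>.
\<close>

definition star_word :: "('a::rat_vector \<Rightarrow> 'a \<Rightarrow> 'a) \<Rightarrow> 'a list \<Rightarrow> 'a list \<Rightarrow> 'a sym"
  where "star_word tri ws zs =
    (\<Sum>\<phi> \<in> {..<length zs} \<rightarrow>\<^sub>E {..length ws}.
      (\<Prod>i<length ws. sym_of (brace tri (ws ! i) (nths zs (\<phi> -` {i}))))
      * (\<Prod>z\<leftarrow>nths zs (\<phi> -` {length ws}). sym_of z))"

text \<open>Bilinear extension of \<open>star_word\<close>, each multiset being enumerated by some list.\<close>

definition star_free ::
    "('a::rat_vector \<Rightarrow> 'a \<Rightarrow> 'a) \<Rightarrow> ('a multiset \<Rightarrow>\<^sub>0 rat) \<Rightarrow> ('a multiset \<Rightarrow>\<^sub>0 rat) \<Rightarrow> 'a sym"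
  where "star_free tri p q =
    poly_extend (\<lambda>W. poly_extend
      (\<lambda>Z. star_word tri (SOME ws. mset ws = W) (SOME zs. mset zs = Z)) q) p"

definition star :: "('a::rat_vector \<Rightarrow> 'a \<Rightarrow> 'a) \<Rightarrow> 'a sym \<Rightarrow> 'a sym \<Rightarrow> 'a sym"
  where "star tri x y = star_free tri (rep_sym x) (rep_sym y)"


section \<open>Well-definedness of \<open>\<ast>\<close>\<close>

text \<open>
  For a Novikov product, \<open>brace\<close> is symmetric and multilinear; hence \<open>star\<close> does not depend on the
  representatives chosen in its definition: it is bilinear and given by \<open>star_word\<close> on products of
  elements of \<open>N\<close>.
\<close>

lemma linearQ_compose: "linearQ g \<Longrightarrow> linearQ h \<Longrightarrow> linearQ (\<lambda>x. g (h x))"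
  by (simp add: linearQ_iff)

lemma linearQ_ident: "linearQ (\<lambda>x. x)"
  by (simp add: linearQ_iff)

lemma linearQ_diff: "linearQ g \<Longrightarrow> linearQ h \<Longrightarrow> linearQ (\<lambda>x. g x - h x)"
  by (auto simp: linearQ_iff rat_vector.scale_right_diff_distrib)

lemma linearQ_sum: "(\<And>i. i \<in> I \<Longrightarrow> linearQ (h i)) \<Longrightarrow> linearQ (\<lambda>x. \<Sum>i\<in>I. h i x)"
  by (auto simp: linearQ_iff sum.distrib rat_vector.scale_sum_right)

lemma scaleQ_sym_mult_left: "(c *\<^sub>Q x) * y = c *\<^sub>Q (x * y)" for x y :: "'a::rat_vector sym"
  by (transfer, rule sym_rel_eqI, rule mult.assoc)

lemma scaleQ_sym_mult_right: "x * (c *\<^sub>Q y) = c *\<^sub>Q (x * y)" for x y :: "'a::rat_vector sym"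
  by (metis scaleQ_sym_mult_left mult.commute)

lemma linearQ_sym_mult:
  fixes z :: "'a::rat_vector sym"
  assumes "linearQ h"
  shows "linearQ (\<lambda>x. h x * z)" and "linearQ (\<lambda>x. z * h x)"
  using assms
  by (auto simp: linearQ_iff scaleQ_sym_mult_left scaleQ_sym_mult_right distrib_left distrib_right)

lemma linearQ_sym_of: "linearQ sym_of"
proof -
  have "sym_of (x + y) = sym_of x + sym_of y" for x y :: 'a
  proof transfer
    fix x y :: 'a
    show "sym_rel (Poly_Mapping.single {#x + y#} 1)
        (Poly_Mapping.single {#x#} 1 + Poly_Mapping.single {#y#} 1)"
      unfolding sym_rel_def sym_ideal_def diff_diff_eq [symmetric]
      by (rule module.span_base[OF module_times]) (auto simp: sym_relators_def)
  qed
  moreover have "sym_of (c *\<^sub>Q x) = c *\<^sub>Q sym_of x" for c and x :: 'a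
  proof transfer
    fix c and x :: 'a
    show "sym_rel (Poly_Mapping.single {#c *\<^sub>Q x#} 1)
        (Poly_Mapping.single 0 c * Poly_Mapping.single {#x#} 1)"
      unfolding sym_rel_def sym_ideal_def mult_single
      by (rule module.span_base[OF module_times]) (auto simp: sym_relators_def)
  qed
  ultimately show ?thesis by (simp add: linearQ_iff)
qed

context novikov_algebra
begin

lemmas tri_simps =
  linear_left[unfolded linearQ_iff, THEN conjunct1, rule_format]
  linear_right[unfolded linearQ_iff, THEN conjunct1, rule_format]

lemma tri_diff_left: "(x - y) \<triangleleft> z = x \<triangleleft> z - y \<triangleleft> z"
  using tri_simps(1)[of "x - y" y z] by (simp add: algebra_simps)

lemma tri_zero_left: "0 \<triangleleft> z = 0"
  using tri_diff_left[of 0 0 z] by simp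

lemma tri_sum_left: "(\<Sum>i\<in>I. h i) \<triangleleft> z = (\<Sum>i\<in>I. h i \<triangleleft> z)"
  by (induction I rule: infinite_finite_induct) (simp_all add: tri_zero_left tri_simps)

lemma linearQ_brace: "j < length ws \<Longrightarrow> linearQ (\<lambda>x. brace (\<triangleleft>) v (ws[j := x]))"
proof (induction "length ws" arbitrary: ws j)
  case 0
  then show ?case by simp
next
  case (Suc n)
  obtain us w where ws: "ws = us @ [w]" and n: "length us = n"
    using Suc(2) by (metis length_Suc_conv_rev)
  show ?case
  proof (cases "j = n")
    case True
    have "linearQ (\<lambda>x. brace (\<triangleleft>) v us \<triangleleft> x - (\<Sum>i<length us. brace (\<triangleleft>) v (us[i := us ! i \<triangleleft> x])))"
      by (intro linearQ_diff linearQ_sum linear_right linearQ_compose[OF Suc(1) linear_right])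
        (use n in auto)
    then show ?thesis by (simp add: ws True n[symmetric])
  next
    case False
    then have j: "j < n" using Suc ws n by simp
    have "linearQ (\<lambda>x. brace (\<triangleleft>) v (us[j := x]) \<triangleleft> w)"
      by (rule linearQ_compose[OF linear_left Suc(1)]) (use n j in auto)
    moreover have "linearQ (\<lambda>x. brace (\<triangleleft>) v (us[j := x, i := us[j := x] ! i \<triangleleft> w]))" if "i < n" for i
    proof (cases "i = j")
      case True
      have "linearQ (\<lambda>x. brace (\<triangleleft>) v (us[j := x \<triangleleft> w]))"
        by (rule linearQ_compose[OF Suc(1) linear_left]) (use n j in auto)
      then show ?thesis using True j n by simp
    next
      case False
      have "linearQ (\<lambda>x. brace (\<triangleleft>) v (us[i := us ! i \<triangleleft> w, j := x]))"
        by (rule Suc(1)) (use n j in auto)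
      then show ?thesis using False j n by (simp add: list_update_swap)
    qed
    ultimately have "linearQ (\<lambda>x. brace (\<triangleleft>) v (us[j := x]) \<triangleleft> w
        - (\<Sum>i<length us. brace (\<triangleleft>) v (us[j := x, i := us[j := x] ! i \<triangleleft> w])))"
      by (intro linearQ_diff linearQ_sum) (use n in auto)
    then show ?thesis using j n by (simp add: ws list_update_append)
  qed
qed

lemma linearQ_brace_left: "linearQ (\<lambda>v. brace (\<triangleleft>) v ws)"
proof (induction "length ws" arbitrary: ws)
  case 0
  then show ?case by (simp add: linearQ_ident)
next
  case (Suc n)
  obtain us w where ws: "ws = us @ [w]" and n: "length us = n"
    using Suc(2) by (metis length_Suc_conv_rev)
  show ?case unfolding ws brace.simps
    by (intro linearQ_diff linearQ_sum linearQ_compose[OF linear_left] Suc(1)) (use n in auto)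
qed

lemma brace_swap: "brace (\<triangleleft>) v (ws @ [a, b]) = brace (\<triangleleft>) v (ws @ [b, a])"
proof -
  let ?n = "length ws"
  let ?V = "brace (\<triangleleft>) v ws"
  define B where "B i x = brace (\<triangleleft>) v (ws[i := x])" for i x
  define C where "C a b = (\<Sum>i<?n. \<Sum>j\<in>{j. j \<in> {..<?n} \<and> i \<noteq> j}. brace (\<triangleleft>) v (ws[i := ws ! i \<triangleleft> b, j := ws ! j \<triangleleft> a]))" for a b
  have B_add: "B i x + B i y = B i (x + y)" if "i < ?n" for i x y
    using linearQ_brace[OF that] unfolding linearQ_iff B_def by simp
  have expand: "brace (\<triangleleft>) v (ws @ [a, b]) =
    (?V \<triangleleft> a) \<triangleleft> b - ?V \<triangleleft> (a \<triangleleft> b) - ((\<Sum>i<?n. B i (ws ! i \<triangleleft> a) \<triangleleft> b) + (\<Sum>i<?n. B i (ws ! i \<triangleleft> b) \<triangleleft> a))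
    + C a b + (\<Sum>i<?n. B i ((ws ! i \<triangleleft> b) \<triangleleft> a + ws ! i \<triangleleft> (a \<triangleleft> b)))" for a b
  proof -
    have 1: "brace (\<triangleleft>) v (ws @ [a, b]) = brace (\<triangleleft>) v (ws @ [a]) \<triangleleft> b
      - (\<Sum>i<Suc ?n. brace (\<triangleleft>) v ((ws @ [a])[i := (ws @ [a]) ! i \<triangleleft> b]))"
      using brace.simps(2)[of "(\<triangleleft>)" v "ws @ [a]" b] by simp
    have 2: "(\<Sum>i<Suc ?n. brace (\<triangleleft>) v ((ws @ [a])[i := (ws @ [a]) ! i \<triangleleft> b]))
      = (\<Sum>i<?n. brace (\<triangleleft>) v (ws[i := ws ! i \<triangleleft> b] @ [a])) + brace (\<triangleleft>) v (ws @ [a \<triangleleft> b])"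
      by (simp add: list_update_append nth_append)
    have 3: "brace (\<triangleleft>) v (ws[i := ws ! i \<triangleleft> b] @ [a]) = B i (ws ! i \<triangleleft> b) \<triangleleft> a
      - (B i ((ws ! i \<triangleleft> b) \<triangleleft> a) + (\<Sum>j\<in>{j. j \<in> {..<?n} \<and> i \<noteq> j}. brace (\<triangleleft>) v (ws[i := ws ! i \<triangleleft> b, j := ws ! j \<triangleleft> a])))"
      if "i < ?n" for i
    proof -
      have "(\<Sum>j<?n. brace (\<triangleleft>) v (ws[i := ws ! i \<triangleleft> b, j := ws[i := ws ! i \<triangleleft> b] ! j \<triangleleft> a]))
        = B i ((ws ! i \<triangleleft> b) \<triangleleft> a) + (\<Sum>j\<in>{j. j \<in> {..<?n} \<and> i \<noteq> j}. brace (\<triangleleft>) v (ws[i := ws ! i \<triangleleft> b, j := ws ! j \<triangleleft> a]))"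
        using that by (subst sum.remove[of _ i]) (auto simp: B_def intro!: sum.cong)
      then show ?thesis by (simp add: B_def)
    qed
    have 4: "(\<Sum>i<?n. brace (\<triangleleft>) v (ws[i := ws ! i \<triangleleft> b] @ [a]))
      = (\<Sum>i<?n. B i (ws ! i \<triangleleft> b) \<triangleleft> a) - (\<Sum>i<?n. B i ((ws ! i \<triangleleft> b) \<triangleleft> a)) - C a b"
      unfolding C_def by (simp add: 3 sum_subtractf sum.distrib del: brace.simps)
    have 5: "(\<Sum>i<?n. B i ((ws ! i \<triangleleft> b) \<triangleleft> a + ws ! i \<triangleleft> (a \<triangleleft> b)))
      = (\<Sum>i<?n. B i ((ws ! i \<triangleleft> b) \<triangleleft> a)) + (\<Sum>i<?n. B i (ws ! i \<triangleleft> (a \<triangleleft> b)))"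
      by (simp add: B_add[symmetric] sum.distrib)
    have 6: "brace (\<triangleleft>) v (ws @ [w]) = ?V \<triangleleft> w - (\<Sum>i<?n. B i (ws ! i \<triangleleft> w))" for w
      by (simp add: B_def)
    show ?thesis
      unfolding 1 2 4 5 6 tri_diff_left tri_sum_left by (simp add: algebra_simps)
  qed
  have "C a b = C b a"
    unfolding C_def
    by (subst sum.swap_restrict)
      (simp_all, intro sum.cong refl, auto simp: list_update_swap)
  moreover have "(ws ! i \<triangleleft> b) \<triangleleft> a + ws ! i \<triangleleft> (a \<triangleleft> b) = (ws ! i \<triangleleft> a) \<triangleleft> b + ws ! i \<triangleleft> (b \<triangleleft> a)" for i
    using right_pre_Lie[of "ws ! i" a b] by (simp add: algebra_simps)
  moreover have "(?V \<triangleleft> a) \<triangleleft> b - ?V \<triangleleft> (a \<triangleleft> b) = (?V \<triangleleft> b) \<triangleleft> a - ?V \<triangleleft> (b \<triangleleft> a)"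
    by (rule right_pre_Lie)
  ultimately show ?thesis unfolding expand by (simp add: add.commute)
qed

lemma brace_mset: "mset ws = mset ws' \<Longrightarrow> brace (\<triangleleft>) v ws = brace (\<triangleleft>) v ws'"
proof (induction "length ws" arbitrary: ws ws')
  case 0
  then show ?case by simp
next
  case (Suc n)
  have last: "brace (\<triangleleft>) v (us @ [w]) = brace (\<triangleleft>) v (us' @ [w])"
    if n: "length us = n" and eq: "mset us = mset us'" for us us' w
  proof -
    define f where "f x = brace (\<triangleleft>) v (SOME zs. mset zs = add_mset (x \<triangleleft> w) (mset us - {#x#}))" for x
    have *: "(\<Sum>i<length ts. brace (\<triangleleft>) v (ts[i := ts ! i \<triangleleft> w])) = sum_mset (image_mset f (mset us))"
      if ts: "mset ts = mset us" for ts
    proof -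
      have "brace (\<triangleleft>) v (ts[i := ts ! i \<triangleleft> w]) = f (ts ! i)" if "i < length ts" for i
        unfolding f_def
      proof (rule Suc(1))
        show "n = length (ts[i := ts ! i \<triangleleft> w])" using mset_eq_length[OF ts] n by simp
        show "mset (ts[i := ts ! i \<triangleleft> w]) = mset (SOME zs. mset zs = add_mset (ts ! i \<triangleleft> w) (mset us - {#ts ! i#}))"
          using someI_ex[OF ex_mset[of "add_mset (ts ! i \<triangleleft> w) (mset us - {#ts ! i#})"]] that ts
          by (simp add: mset_update)
      qed
      then have "(\<Sum>i<length ts. brace (\<triangleleft>) v (ts[i := ts ! i \<triangleleft> w])) = sum_list (map f ts)"
        by (simp add: sum_list_sum_nth atLeast0LessThan)
      also have "\<dots> = sum_mset (image_mset f (mset us))"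
        by (metis ts mset_map sum_mset_sum_list)
      finally show ?thesis .
    qed
    show ?thesis using Suc(1)[of us us'] n eq *[of us] *[of us'] by simp
  qed
  obtain us w where ws: "ws = us @ [w]" and n: "length us = n"
    using Suc(2) by (metis length_Suc_conv_rev)
  have "length ws' = Suc n" using Suc(2,3) by (metis mset_eq_length)
  then obtain us' w' where ws': "ws' = us' @ [w']" and n': "length us' = n"
    by (metis length_Suc_conv_rev)
  show ?case
  proof (cases "w = w'")
    case True
    then show ?thesis using last[OF n] Suc(3) ws ws' by simp
  next
    case False
    then have eq: "add_mset w (mset us) = add_mset w' (mset us')" using Suc(3) ws ws' by simp
    then obtain T where T: "mset us = add_mset w' T" "mset us' = add_mset w T"
      using False by (metis add_eq_conv_ex)
    obtain ts where ts: "mset ts = T" using ex_mset by blast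
    have "brace (\<triangleleft>) v ws = brace (\<triangleleft>) v (ts @ [w', w])"
      using last[OF n, of "ts @ [w']" w] T ts by (simp add: ws)
    also have "\<dots> = brace (\<triangleleft>) v (ts @ [w, w'])" by (rule brace_swap)
    also have "\<dots> = brace (\<triangleleft>) v ws'"
      using last[OF n', of "ts @ [w]" w'] T ts by (simp add: ws')
    finally show ?thesis .
  qed
qed

end

lemma mset_nths: "mset (nths xs A) = image_mset ((!) xs) (mset_set {j. j < length xs \<and> j \<in> A})"
proof (induction xs rule: rev_induct)
  case Nil
  then show ?case by simp
next
  case (snoc x xs)
  let ?J = "{j. j < length xs \<and> j \<in> A}"
  have "{j. j < length (xs @ [x]) \<and> j \<in> A} = (if length xs \<in> A then insert (length xs) ?J else ?J)"
    by (auto simp: less_Suc_eq)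
  moreover have "image_mset ((!) (xs @ [x])) (mset_set ?J) = image_mset ((!) xs) (mset_set ?J)"
    by (intro image_mset_cong) (auto simp: nth_append)
  ultimately show ?case using snoc by (simp add: nths_append)
qed

lemma nths_cong: "(\<And>j. j < length xs \<Longrightarrow> j \<in> A \<longleftrightarrow> j \<in> B) \<Longrightarrow> nths xs A = nths xs B"
  unfolding nths_def by (intro arg_cong[where f = "map fst"] filter_cong refl) (auto simp: set_zip)

lemma prod_list_map_mset: "mset xs = mset ys \<Longrightarrow> prod_list (map h xs) = prod_list (map h ys)"
  for h :: "'a \<Rightarrow> 'b::comm_monoid_mult"
  by (metis mset_map prod_mset_prod_list)

lemma linearQ_scale: "linearQ h \<Longrightarrow> linearQ (\<lambda>x. c *\<^sub>Q h x)"
  by (simp add: linearQ_iff scaleQ_add_right mult.commute)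

lemma poly_extend_diff: "poly_extend h (p - q) = poly_extend h p - poly_extend h q"
  using poly_extend_add[of h "p - q" q] by (simp add: algebra_simps)

lemma poly_extend_scale:
  "poly_extend h (Poly_Mapping.single (0::'k::monoid_add) c * p) = c *\<^sub>Q poly_extend h p"
  by (induction p rule: poly_mapping_monomial_induct)
    (simp_all add: mult_single poly_extend_single poly_extend_add distrib_left scaleQ_add_right)

lemma poly_extend_ideal:
  assumes h: "\<And>M. linearQ (\<lambda>x. h (add_mset x M))" and p: "p \<in> sym_ideal"
  shows "poly_extend h p = 0"
  using p
proof (induction rule: sym_ideal_induct)
  case zero
  then show ?case by (simp add: poly_extend_def)
next
  case (add p q)
  then show ?case by (simp add: poly_extend_add)
next
  case (add_rel M c x y)
  then show ?case using h[of M]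
    by (simp add: poly_extend_diff poly_extend_single linearQ_iff scaleQ_add_right)
next
  case (scale_rel M c d x)
  then show ?case using h[of M]
    by (simp add: poly_extend_diff poly_extend_single linearQ_iff mult.commute)
qed

lemma inj_sym_of: "inj sym_of"
proof (rule injI)
  fix x y :: 'a
  define h where "h M = (if size M = 1 then sum_mset M else 0)" for M :: "'a multiset"
  assume "sym_of x = sym_of y"
  then have "Poly_Mapping.single {#x#} 1 - Poly_Mapping.single {#y#} 1 \<in> sym_ideal"
    by (simp add: sym_of.abs_eq sym.abs_eq_iff sym_rel_def)
  moreover have "linearQ (\<lambda>x. h (add_mset x M))" for M
    by (cases "M = {#}") (simp_all add: h_def linearQ_iff)
  ultimately have "poly_extend h (Poly_Mapping.single {#x#} 1 - Poly_Mapping.single {#y#} 1) = 0"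
    by (intro poly_extend_ideal)
  then show "x = y"
    by (simp add: poly_extend_diff poly_extend_single h_def)
qed

lemma prod_list_sym_of: "(\<Prod>w\<leftarrow>ws. sym_of w) = abs_sym (Poly_Mapping.single (mset ws) 1)"
proof (induction ws)
  case Nil
  then show ?case by (simp add: one_sym.abs_eq zero_multiset_def[symmetric])
next
  case (Cons w ws)
  then show ?case by (simp add: sym_of.abs_eq times_sym.abs_eq mult_single)
qed

context novikov_algebra
begin

lemma star_word_mset_right:
  assumes "mset zs = mset zs'"
  shows "star_word (\<triangleleft>) ws zs = star_word (\<triangleleft>) ws zs'"
proof -
  define m where "m = length zs'"
  obtain p where p: "p permutes {..<m}" and zs: "permute_list p zs' = zs"
    using mset_eq_permutation[OF assms] m_def by metis
  have m: "length zs = m" using assms m_def by (metis mset_eq_length)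
  have q: "inv p permutes {..<m}" using p by (rule permutes_inv)
  have lt: "p j < m \<longleftrightarrow> j < m" "inv p j < m \<longleftrightarrow> j < m" for j
    using permutes_in_image[OF p, of j] permutes_in_image[OF q, of j] by auto
  have inv: "p (inv p j) = j" "inv p (p j) = j" for j
    using permutes_inverses[OF p] by auto
  have nth: "zs ! j = zs' ! p j" if "j < m" for j
    using permute_list_nth[of p zs' j] p zs that m_def by auto
  define J where "J \<phi> = restrict (\<lambda>j. \<phi> (inv p j)) {..<m}" for \<phi> :: "nat \<Rightarrow> nat"
  have fibre: "mset (nths zs (\<phi> -` {i})) = mset (nths zs' (J \<phi> -` {i}))" for \<phi> i
  proof -
    let ?F = "{j. j < m \<and> \<phi> j = i}"
    have "mset (nths zs (\<phi> -` {i})) = image_mset ((!) zs) (mset_set ?F)"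
      by (simp add: mset_nths m)
    also have "\<dots> = image_mset ((!) zs') (image_mset p (mset_set ?F))"
      unfolding multiset.map_comp by (intro image_mset_cong) (simp add: nth)
    also have "image_mset p (mset_set ?F) = mset_set (p ` ?F)"
      by (intro image_mset_mset_set inj_on_subset[OF permutes_inj[OF p]]) simp
    also have "p ` ?F = {j. j < length zs' \<and> j \<in> J \<phi> -` {i}}"
    proof (intro set_eqI iffI)
      fix k assume "k \<in> p ` ?F"
      then show "k \<in> {j. j < length zs' \<and> j \<in> J \<phi> -` {i}}"
        by (auto simp: J_def lt inv m_def[symmetric])
    next
      fix k assume "k \<in> {j. j < length zs' \<and> j \<in> J \<phi> -` {i}}"
      then show "k \<in> p ` ?F"
        by (intro image_eqI[of _ _ "inv p k"]) (auto simp: J_def lt inv m_def[symmetric])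
    qed
    finally show ?thesis by (simp add: mset_nths)
  qed
  show ?thesis
    unfolding star_word_def m m_def[symmetric]
  proof (rule sum.reindex_bij_witness[where j = J and i = "\<lambda>\<psi>. restrict (\<lambda>j. \<psi> (p j)) {..<m}"])
    fix \<phi> assume \<phi>: "\<phi> \<in> {..<m} \<rightarrow>\<^sub>E {..length ws}"
    show "restrict (\<lambda>j. J \<phi> (p j)) {..<m} = \<phi>"
      by (rule PiE_ext[OF _ \<phi>]) (use \<phi> in \<open>auto simp: J_def lt inv PiE_iff\<close>)
    show "J \<phi> \<in> {..<m} \<rightarrow>\<^sub>E {..length ws}"
      using \<phi> by (auto simp: J_def lt PiE_iff)
    show "(\<Prod>i<length ws. sym_of (brace (\<triangleleft>) (ws ! i) (nths zs' (J \<phi> -` {i})))) *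
        (\<Prod>z\<leftarrow>nths zs' (J \<phi> -` {length ws}). sym_of z) =
      (\<Prod>i<length ws. sym_of (brace (\<triangleleft>) (ws ! i) (nths zs (\<phi> -` {i})))) *
        (\<Prod>z\<leftarrow>nths zs (\<phi> -` {length ws}). sym_of z)"
      by (simp only: brace_mset[OF fibre] prod_list_map_mset[OF fibre])
  next
    fix \<psi> assume \<psi>: "\<psi> \<in> {..<m} \<rightarrow>\<^sub>E {..length ws}"
    show "J (restrict (\<lambda>j. \<psi> (p j)) {..<m}) = \<psi>"
      by (rule PiE_ext[OF _ \<psi>]) (use \<psi> in \<open>auto simp: J_def lt inv PiE_iff\<close>)
    show "restrict (\<lambda>j. \<psi> (p j)) {..<m} \<in> {..<m} \<rightarrow>\<^sub>E {..length ws}"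
      using \<psi> by (auto simp: lt PiE_iff)
  qed
qed

lemma star_word_mset_left:
  assumes "mset ws = mset ws'"
  shows "star_word (\<triangleleft>) ws zs = star_word (\<triangleleft>) ws' zs"
proof -
  define n where "n = length ws'"
  define m where "m = length zs"
  obtain p where p: "p permutes {..<n}" and ws: "permute_list p ws' = ws"
    using mset_eq_permutation[OF assms] n_def by metis
  have n: "length ws = n" using assms n_def by (metis mset_eq_length)
  have q: "inv p permutes {..<n}" using p by (rule permutes_inv)
  have pn: "p n = n" using p by (simp add: permutes_def)
  have sub: "{..<n} \<subseteq> {..n}" by auto
  have le: "p j \<le> n \<longleftrightarrow> j \<le> n" "inv p j \<le> n \<longleftrightarrow> j \<le> n" for j
    using permutes_in_image[OF permutes_subset[OF p sub], of j]
      permutes_in_image[OF permutes_subset[OF q sub], of j] by auto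
  have inv: "p (inv p j) = j" "inv p (p j) = j" for j
    using permutes_inverses[OF p] by auto
  have nth: "ws ! i = ws' ! p i" if "i < n" for i
    using permute_list_nth[of p ws' i] p ws that n_def by auto
  define J where "J \<phi> = restrict (\<lambda>j. p (\<phi> j)) {..<m}" for \<phi> :: "nat \<Rightarrow> nat"
  have fibre: "nths zs (J \<phi> -` {p i}) = nths zs (\<phi> -` {i})" for \<phi> i
    by (rule nths_cong) (simp add: J_def m_def inj_eq[OF permutes_inj[OF p]])
  show ?thesis
    unfolding star_word_def n n_def[symmetric] m_def[symmetric]
  proof (rule sum.reindex_bij_witness[where j = J and i = "\<lambda>\<psi>. restrict (\<lambda>j. inv p (\<psi> j)) {..<m}"])
    fix \<phi> assume \<phi>: "\<phi> \<in> {..<m} \<rightarrow>\<^sub>E {..n}"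
    show "restrict (\<lambda>j. inv p (J \<phi> j)) {..<m} = \<phi>"
      by (rule PiE_ext[OF _ \<phi>]) (use \<phi> in \<open>auto simp: J_def le inv PiE_iff\<close>)
    show "J \<phi> \<in> {..<m} \<rightarrow>\<^sub>E {..n}"
      using \<phi> by (auto simp: J_def le PiE_iff)
    have "(\<Prod>i<n. sym_of (brace (\<triangleleft>) (ws' ! i) (nths zs (J \<phi> -` {i})))) =
      (\<Prod>i<n. sym_of (brace (\<triangleleft>) (ws' ! p i) (nths zs (J \<phi> -` {p i}))))"
      using prod.permute[OF p, of "\<lambda>i. sym_of (brace (\<triangleleft>) (ws' ! i) (nths zs (J \<phi> -` {i})))"]
      by (simp add: o_def)
    also have "\<dots> = (\<Prod>i<n. sym_of (brace (\<triangleleft>) (ws ! i) (nths zs (\<phi> -` {i}))))"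
      by (simp add: fibre nth)
    finally show "(\<Prod>i<n. sym_of (brace (\<triangleleft>) (ws' ! i) (nths zs (J \<phi> -` {i})))) *
        (\<Prod>z\<leftarrow>nths zs (J \<phi> -` {n}). sym_of z) =
      (\<Prod>i<n. sym_of (brace (\<triangleleft>) (ws ! i) (nths zs (\<phi> -` {i})))) *
        (\<Prod>z\<leftarrow>nths zs (\<phi> -` {n}). sym_of z)"
      using fibre[of \<phi> n] by (simp add: pn)
  next
    fix \<psi> assume \<psi>: "\<psi> \<in> {..<m} \<rightarrow>\<^sub>E {..n}"
    show "J (restrict (\<lambda>j. inv p (\<psi> j)) {..<m}) = \<psi>"
      by (rule PiE_ext[OF _ \<psi>]) (use \<psi> in \<open>auto simp: J_def le inv PiE_iff\<close>)
    show "restrict (\<lambda>j. inv p (\<psi> j)) {..<m} \<in> {..<m} \<rightarrow>\<^sub>E {..n}"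
      using \<psi> by (auto simp: le PiE_iff)
  qed
qed

lemma linearQ_star_word_left: "linearQ (\<lambda>x. star_word (\<triangleleft>) (x # ws) zs)"
  unfolding star_word_def
  by (simp only: list.size(4) prod.lessThan_Suc_shift nth_Cons_0 nth_Cons_Suc add_Suc_right add_0_right)
    (intro linearQ_sum linearQ_sym_mult linearQ_compose[OF linearQ_sym_of] linearQ_brace_left)

lemma linearQ_brace_Cons: "linearQ (\<lambda>x. brace (\<triangleleft>) v (x # ws))"
  using linearQ_brace[of 0 "undefined # ws" v] by simp

lemma linearQ_star_word_right: "linearQ (\<lambda>x. star_word (\<triangleleft>) ws (x # zs))"
  unfolding star_word_def
proof (simp only: list.size(4), rule linearQ_sum)
  let ?n = "length ws"
  fix \<phi> assume "\<phi> \<in> {..<length zs + Suc 0} \<rightarrow>\<^sub>E {..?n}"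
  then have "\<phi> 0 \<le> ?n" by (auto simp: PiE_iff)
  show "linearQ (\<lambda>x. (\<Prod>i<?n. sym_of (brace (\<triangleleft>) (ws ! i) (nths (x # zs) (\<phi> -` {i}))))
      * (\<Prod>z\<leftarrow>nths (x # zs) (\<phi> -` {?n}). sym_of z))"
  proof (cases "\<phi> 0 = ?n")
    case True
    then show ?thesis
      by (simp add: nths_Cons) (intro linearQ_sym_mult linearQ_sym_of)
  next
    case False
    then have lt: "\<phi> 0 \<in> {..<?n}" using \<open>\<phi> 0 \<le> ?n\<close> by simp
    have eq: "(\<Prod>i<?n. sym_of (brace (\<triangleleft>) (ws ! i) (nths (x # zs) (\<phi> -` {i})))) =
      sym_of (brace (\<triangleleft>) (ws ! \<phi> 0) (x # nths zs {j. \<phi> (Suc j) = \<phi> 0})) *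
      (\<Prod>i\<in>{..<?n} - {\<phi> 0}. sym_of (brace (\<triangleleft>) (ws ! i) (nths zs {j. \<phi> (Suc j) = i})))" for x
      by (subst prod.remove[OF _ lt]) (auto simp: nths_Cons intro!: prod.cong)
    show ?thesis
      unfolding eq using False
      by (simp add: nths_Cons)
        (intro linearQ_sym_mult linearQ_compose[OF linearQ_sym_of] linearQ_brace_Cons)
  qed
qed

abbreviation star_mset :: "'a multiset \<Rightarrow> 'a multiset \<Rightarrow> 'a sym"
  where "star_mset W Z \<equiv> star_word (\<triangleleft>) (SOME ws. mset ws = W) (SOME zs. mset zs = Z)"

lemma star_mset: "star_mset (mset ws) (mset zs) = star_word (\<triangleleft>) ws zs"
proof -
  have some: "mset (SOME xs'. mset xs' = mset xs) = mset xs" for xs :: "'a list"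
    by (rule someI) (rule refl)
  show ?thesis
    unfolding star_word_mset_left[OF some] star_word_mset_right[OF some] ..
qed

lemma linearQ_star_mset_left: "linearQ (\<lambda>x. star_mset (add_mset x W) Z)"
proof -
  obtain ws zs where "W = mset ws" "Z = mset zs" using ex_mset by metis
  then have "star_mset (add_mset x W) Z = star_word (\<triangleleft>) (x # ws) zs" for x
    using star_mset[of "x # ws" zs] by simp
  then show ?thesis by (simp only: linearQ_star_word_left)
qed

lemma linearQ_star_mset_right: "linearQ (\<lambda>x. star_mset W (add_mset x Z))"
proof -
  obtain ws zs where "W = mset ws" "Z = mset zs" using ex_mset by metis
  then have "star_mset W (add_mset x Z) = star_word (\<triangleleft>) ws (x # zs)" for x
    using star_mset[of ws "x # zs"] by simp
  then show ?thesis by (simp only: linearQ_star_word_right)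
qed


lemma star_free_eq: "star_free (\<triangleleft>) p q = poly_extend (\<lambda>W. poly_extend (star_mset W) q) p"
  by (simp add: star_free_def)

lemma star_free_eq': "star_free (\<triangleleft>) p q = poly_extend (\<lambda>Z. poly_extend (\<lambda>W. star_mset W Z) p) q"
  unfolding star_free_eq poly_extend_def rat_vector.scale_sum_right
  by (subst sum.swap) (simp add: mult.commute)

lemma star_free_ideal_left: "p \<in> sym_ideal \<Longrightarrow> star_free (\<triangleleft>) p q = 0"
proof -
  have "linearQ (\<lambda>x. poly_extend (star_mset (add_mset x W)) q)" for W
    unfolding poly_extend_def by (intro linearQ_sum linearQ_scale linearQ_star_mset_left)
  then show "p \<in> sym_ideal \<Longrightarrow> star_free (\<triangleleft>) p q = 0"
    unfolding star_free_eq by (rule poly_extend_ideal)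
qed

lemma star_free_ideal_right: "q \<in> sym_ideal \<Longrightarrow> star_free (\<triangleleft>) p q = 0"
proof -
  have "linearQ (\<lambda>x. poly_extend (\<lambda>W. star_mset W (add_mset x Z)) p)" for Z
    unfolding poly_extend_def by (intro linearQ_sum linearQ_scale linearQ_star_mset_right)
  then show "q \<in> sym_ideal \<Longrightarrow> star_free (\<triangleleft>) p q = 0"
    unfolding star_free_eq' by (rule poly_extend_ideal)
qed

lemma star_abs_sym: "star (\<triangleleft>) (abs_sym p) (abs_sym q) = star_free (\<triangleleft>) p q"
proof -
  have rep: "rep_sym (abs_sym r) - r \<in> sym_ideal" for r :: "'a multiset \<Rightarrow>\<^sub>0 rat"
    using Quotient3_rep_abs[OF Quotient3_sym, of r] by (simp add: sym_rel_def sym_ideal_0)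
  have "star_free (\<triangleleft>) (rep_sym (abs_sym p)) r = star_free (\<triangleleft>) p r" for r
    using star_free_ideal_left[OF rep, of p r] by (simp add: star_free_eq poly_extend_diff)
  moreover have "star_free (\<triangleleft>) r (rep_sym (abs_sym q)) = star_free (\<triangleleft>) r q" for r
    using star_free_ideal_right[OF rep, of r q] by (simp add: star_free_eq' poly_extend_diff)
  ultimately show ?thesis by (simp add: star_def)
qed

lemma star_monomials:
  "star (\<triangleleft>) (\<Prod>w\<leftarrow>ws. sym_of w) (\<Prod>z\<leftarrow>zs. sym_of z) = star_word (\<triangleleft>) ws zs"
  by (simp add: prod_list_sym_of star_abs_sym star_free_eq poly_extend_single star_mset)

lemma linearQ_star_left: "linearQ (\<lambda>x. star (\<triangleleft>) x y)"
proof -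
  obtain q where y: "y = abs_sym q" by (metis Quotient3_abs_rep[OF Quotient3_sym])
  have "star (\<triangleleft>) (x + x') y = star (\<triangleleft>) x y + star (\<triangleleft>) x' y" for x x'
  proof -
    obtain p p' where "x = abs_sym p" "x' = abs_sym p'" by (metis Quotient3_abs_rep[OF Quotient3_sym])
    then show ?thesis
      by (simp add: y plus_sym.abs_eq star_abs_sym star_free_eq poly_extend_add)
  qed
  moreover have "star (\<triangleleft>) (c *\<^sub>Q x) y = c *\<^sub>Q star (\<triangleleft>) x y" for c x
  proof -
    obtain p where "x = abs_sym p" by (metis Quotient3_abs_rep[OF Quotient3_sym])
    then show ?thesis
      by (simp add: y scaleQ_sym.abs_eq star_abs_sym star_free_eq poly_extend_scale)
  qed
  ultimately show ?thesis by (simp add: linearQ_iff)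
qed

lemma linearQ_star_right: "linearQ (\<lambda>y. star (\<triangleleft>) x y)"
proof -
  obtain p where x: "x = abs_sym p" by (metis Quotient3_abs_rep[OF Quotient3_sym])
  have "star (\<triangleleft>) x (y + y') = star (\<triangleleft>) x y + star (\<triangleleft>) x y'" for y y'
  proof -
    obtain q q' where "y = abs_sym q" "y' = abs_sym q'" by (metis Quotient3_abs_rep[OF Quotient3_sym])
    then show ?thesis
      by (simp add: x plus_sym.abs_eq star_abs_sym star_free_eq' poly_extend_add)
  qed
  moreover have "star (\<triangleleft>) x (c *\<^sub>Q y) = c *\<^sub>Q star (\<triangleleft>) x y" for c y
  proof -
    obtain q where "y = abs_sym q" by (metis Quotient3_abs_rep[OF Quotient3_sym])
    then show ?thesis
      by (simp add: x scaleQ_sym.abs_eq star_abs_sym star_free_eq' poly_extend_scale)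
  qed
  ultimately show ?thesis by (simp add: linearQ_iff)
qed

end


unbundle fps_syntax

section \<open>Exponential, logarithm and pre-Lie logarithm\<close>

text \<open>
  The formal parameter \<open>\<lambda>\<close> is the indeterminate of \<open>'a sym fps\<close>, whose multiplication
  extends \<open>\<odot>\<close>. Exponentials are taken of series without constant term and logarithms of
  series with constant term \<open>1\<close>, so only the first \<open>n\<close> powers contribute to the coefficient
  of \<open>\<lambda>\<^sup>n\<close>.
\<close>

definition sym_exp :: "'a::rat_vector sym fps \<Rightarrow> 'a sym fps"
  where "sym_exp F = Abs_fps (\<lambda>n. \<Sum>m\<le>n. (1 / fact m) *\<^sub>Q ((F ^ m) $ n))"

definition star_fps ::
    "('a::rat_vector \<Rightarrow> 'a \<Rightarrow> 'a) \<Rightarrow> 'a sym fps \<Rightarrow> 'a sym fps \<Rightarrow> 'a sym fps"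
  where "star_fps tri F G = Abs_fps (\<lambda>n. \<Sum>i\<le>n. star tri (F $ i) (G $ (n - i)))"

primrec star_power :: "('a::rat_vector \<Rightarrow> 'a \<Rightarrow> 'a) \<Rightarrow> 'a sym fps \<Rightarrow> nat \<Rightarrow> 'a sym fps"
  where
    "star_power tri F 0 = 1"
  | "star_power tri F (Suc m) = star_fps tri (star_power tri F m) F"

definition star_log :: "('a::rat_vector \<Rightarrow> 'a \<Rightarrow> 'a) \<Rightarrow> 'a sym fps \<Rightarrow> 'a sym fps"
  where "star_log tri F =
    Abs_fps (\<lambda>n. \<Sum>m=1..n. ((-1) ^ (m + 1) / of_nat m) *\<^sub>Q (star_power tri (F - 1) m $ n))"

text \<open>\<open>prelie_log tri f\<close> is \<open>log\<^sub>\<triangleleft>(\<lambda> f)\<close>.\<close>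

definition prelie_log :: "('a::rat_vector \<Rightarrow> 'a \<Rightarrow> 'a) \<Rightarrow> 'a \<Rightarrow> 'a sym fps"
  where "prelie_log tri f = star_log tri (sym_exp (fps_const (sym_of f) * fps_X))"


section \<open>Commutative algebras with derivation\<close>

class rat_comm_algebra = rat_vector + comm_ring +
  assumes scaleQ_mult_left: "(c *\<^sub>Q x) * y = c *\<^sub>Q (x * y)"

locale derivation =
  fixes D :: "'a::rat_comm_algebra \<Rightarrow> 'a"
  assumes linear: "linearQ D"
    and Leibniz: "D (x * y) = D x * y + x * D y"

lemma (in derivation) novikov: "novikov_algebra (\<lambda>a b. D a * b)"
proof -
  have [simp]: "D (c *\<^sub>Q x) = c *\<^sub>Q D x" "D (x + y) = D x + D y" for c x y
    using linear by (simp_all add: linearQ_iff)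
  have [simp]: "x * (c *\<^sub>Q y) = c *\<^sub>Q (x * y)" for c and x y :: 'a
    using scaleQ_mult_left by (metis mult.commute)
  show ?thesis
    by unfold_locales
      (auto simp: linearQ_iff algebra_simps Leibniz scaleQ_mult_left)
qed

text \<open>
  Algebras are not required to be unital, so only powers \<open>x\<^sup>k\<close> with \<open>k \<ge> 1\<close> make sense
  (\<open>pos_power x 0\<close> is irrelevant).
\<close>

definition pos_power :: "'a::semigroup_mult \<Rightarrow> nat \<Rightarrow> 'a"
  where "pos_power x k = ((*) x ^^ (k - 1)) x"

definition compositions :: "nat \<Rightarrow> nat \<Rightarrow> nat list set"
  where "compositions n i = {ks. length ks = i \<and> (\<forall>k\<in>set ks. 0 < k) \<and> sum_list ks = n}"

lemma finite_compositions: "finite (compositions n i)"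
proof (rule finite_subset)
  show "compositions n i \<subseteq> {ks. set ks \<subseteq> {..n} \<and> length ks = i}"
    by (auto simp: compositions_def member_le_sum_list)
  show "finite {ks. set ks \<subseteq> {..n} \<and> length ks = i}"
    by (rule finite_lists_length_eq) simp
qed

end

theory Submission
  imports Defs "HOL-Computational_Algebra.Polynomial"
begin

text \<open>
  Let \<open>E = exp\<^sub>\<odot>(\<lambda> f)\<close> and let \<open>T\<close> be the operator \<open>v \<mapsto> v{E}\<close> on \<open>N[[\<lambda>]]\<close>. Right multiplication by
  \<open>E\<close> has the form \<open>y \<mapsto> \<Phi>(y) \<odot> E\<close> with \<open>\<Phi>\<close> the ring endomorphism that extends \<open>T\<close>, so the
  \<open>x\<close>-th \<open>\<ast>\<close>-power of \<open>E\<close> is \<open>exp\<^sub>\<odot>(a\<^sub>x)\<close> with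
  \<open>a\<^sub>x = (1 + T + \<dots> + T\<^sup>x\<^sup>-\<^sup>1)(\<lambda> f) = \<Sum>\<^sub>k (x choose k + 1) (T - 1)\<^sup>k (\<lambda> f)\<close>.
  Coefficientwise this is polynomial in \<open>x\<close>, and \<open>log\<^sub>\<ast> E\<close> is the derivative at \<open>x = 0\<close>. As
  \<open>a\<^sub>0 = 0\<close>, only the linear term of the exponential contributes, and the derivative of
  \<open>x choose k + 1\<close> at \<open>0\<close> is \<open>(-1)\<^sup>k / (k + 1)\<close>. Expanding \<open>(T - 1)\<^sup>k\<close> gives the sum over
  compositions. In an algebra with derivation, \<open>v{w\<^sub>1 \<cdots> w\<^sub>n} = \<partial>\<^sup>n(v) w\<^sub>1 \<cdots> w\<^sub>n\<close>.
\<close>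

section \<open>Finite differences\<close>

primrec fdiff :: "nat \<Rightarrow> (nat \<Rightarrow> 'r::ab_group_add) \<Rightarrow> nat \<Rightarrow> 'r"
  where
    "fdiff 0 g = g"
  | "fdiff (Suc m) g = (\<lambda>x. fdiff m g (Suc x) - fdiff m g x)"

lemma fdiff_add: "fdiff m (\<lambda>x. g x + h x) x = fdiff m g x + fdiff m h x"
  by (induction m arbitrary: x) simp_all

lemma fdiff_const: "fdiff m (\<lambda>x. c) x = (if m = 0 then c else 0)"
  by (induction m arbitrary: x) simp_all

lemma fdiff_fps_nth: "fdiff m g x $ n = fdiff m (\<lambda>x. g x $ n) x"
  by (induction m arbitrary: x) simp_all

text \<open>The product rule for differences: the factor \<open>x\<close> has constant first
  difference, so only two terms remain. At \<open>m = 0\<close> the truncated \<open>m - 1\<close>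
  is harmless because of the factor \<open>of_nat m\<close>.\<close>

lemma fdiff_of_nat_mult:
  fixes h :: "nat \<Rightarrow> 'r::comm_ring_1"
  shows "fdiff m (\<lambda>x. of_nat x * h x) x = of_nat x * fdiff m h x + of_nat m * fdiff (m - 1) h (Suc x)"
proof (induction m arbitrary: x)
  case (Suc m)
  have "fdiff (Suc m) (\<lambda>x. of_nat x * h x) x =
      of_nat (Suc x) * fdiff m h (Suc x) + of_nat m * fdiff (m - 1) h (Suc (Suc x))
      - (of_nat x * fdiff m h x + of_nat m * fdiff (m - 1) h (Suc x))"
    by (simp only: fdiff.simps Suc)
  also have "\<dots> = of_nat x * fdiff (Suc m) h x + of_nat (Suc m) * fdiff m h (Suc x)"
    by (cases m) (simp_all add: algebra_simps)
  finally show ?case by simp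
qed simp

text \<open>An equality of functions, so that it rewrites the argument of
  \<open>fdiff\<close>.\<close>

lemma poly_pCons_of_nat:
  "(\<lambda>x. poly (pCons c p) (of_nat x)) = (\<lambda>x. c + of_nat x * poly p (of_nat x))"
  for p :: "'r::comm_ring_1 poly"
  by simp

text \<open>Induction in Horner form: by the product rule, multiplying by \<open>x\<close> costs one
  more difference, just as it raises the degree by one.\<close>

lemma fdiff_poly_eq_0:
  fixes p :: "'r::comm_ring_1 poly"
  assumes "degree p < m"
  shows "fdiff m (\<lambda>x. poly p (of_nat x)) x = 0"
  using assms
proof (induction p arbitrary: m x)
  case 0
  then show ?case by (simp add: fdiff_const)
next
  case (pCons c p)
  show ?case
  proof (cases "p = 0")
    case True
    then show ?thesis using pCons.prems by (simp add: fdiff_const)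
  next
    case False
    then have "degree p < m" "degree p < m - 1" using pCons.prems by auto
    then show ?thesis
      using pCons.IH pCons.prems
      unfolding poly_pCons_of_nat fdiff_add fdiff_of_nat_mult by (simp add: fdiff_const)
  qed
qed


section \<open>Rational scalars in the symmetric algebra\<close>

text \<open>Scalars become ring elements, so that ring identities and polynomials over
  \<open>'a sym\<close> can carry them.\<close>

definition sym_scalar :: "rat \<Rightarrow> 'a::rat_vector sym"
  where "sym_scalar c = c *\<^sub>Q 1"

lemma scaleQ_sym_eq: "c *\<^sub>Q x = sym_scalar c * x" for x :: "'a::rat_vector sym"
  by (simp add: sym_scalar_def scaleQ_sym_mult_left)

lemma sym_scalar_add: "sym_scalar (c + d) = sym_scalar c + sym_scalar d"
  by (simp add: sym_scalar_def scaleQ_add_left)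

lemma sym_scalar_mult: "sym_scalar (c * d) = sym_scalar c * sym_scalar d"
  by (simp add: sym_scalar_def scaleQ_sym_mult_left scaleQ_scaleQ)

lemma sym_scalar_1 [simp]: "sym_scalar 1 = 1"
  by (simp add: sym_scalar_def scaleQ_one)

lemma sym_scalar_0 [simp]: "sym_scalar 0 = 0"
  by (simp add: sym_scalar_def)

lemma sym_scalar_minus: "sym_scalar (- c) = - sym_scalar c"
  by (simp add: sym_scalar_def)

lemma sym_scalar_of_nat [simp]: "sym_scalar (of_nat n) = of_nat n"
  by (induction n) (simp_all add: sym_scalar_add)

text \<open>
  On functions \<open>x \<mapsto> p(x)\<close> with \<open>p\<close> polynomial, the logarithm series in the difference operator is
  \<open>d/dx\<close>, here evaluated at \<open>0\<close>: on \<open>x h(x)\<close> it telescopes to \<open>h(0)\<close>.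
\<close>

lemma log_fdiff_poly:
  fixes p :: "'a::rat_vector sym poly"
  assumes "degree p \<le> n"
  shows "(\<Sum>m=1..n. sym_scalar ((-1) ^ (m + 1) / of_nat m) * fdiff m (\<lambda>x. poly p (of_nat x)) 0)
    = coeff p 1"
proof -
  obtain c h where p: "p = pCons c h" by (rule pCons_cases)
  let ?d = "\<lambda>m. fdiff m (\<lambda>x. poly h (of_nat x)) 0"
  \<comment> \<open>The factor \<open>m\<close> from the product rule at 0 cancels the denominator
    of the logarithm series.\<close>
  have summand: "sym_scalar ((-1) ^ (m + 1) / of_nat m) * fdiff m (\<lambda>x. poly p (of_nat x)) 0
      = (-1) ^ (m + 1) * (?d (m - 1) + ?d m)" if "0 < m" for m
  proof -
    have "fdiff m (\<lambda>x. poly p (of_nat x)) 0 = of_nat m * (?d (m - 1) + ?d m)"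
      unfolding p poly_pCons_of_nat fdiff_add fdiff_of_nat_mult
      using that by (cases m) (simp_all add: fdiff_const)
    moreover have "sym_scalar ((-1) ^ (m + 1) / of_nat m) * (of_nat m :: 'a sym) = (-1) ^ (m + 1)"
      using that by (cases "even m")
        (simp_all add: sym_scalar_minus flip: sym_scalar_of_nat sym_scalar_mult)
    ultimately show ?thesis by (simp only: mult.assoc[symmetric])
  qed
  have tele: "(\<Sum>m=1..n. (-1) ^ (m + 1) * (?d (m - 1) + ?d m)) = ?d 0 - (-1) ^ n * ?d n" for n
    by (induction n) (simp_all add: algebra_simps)
  \<comment> \<open>If \<open>h\<close> is nonzero, its degree is below \<open>n\<close>, so the
    boundary term of the telescoping sum vanishes.\<close>
  have "(-1) ^ n * ?d n = 0 \<or> n = 0 \<and> h = 0"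
  proof (cases "h = 0")
    case False
    then show ?thesis using assms p fdiff_poly_eq_0[of h n] by simp
  qed (simp add: fdiff_const)
  then have "?d 0 - (-1) ^ n * ?d n = coeff p 1" by (auto simp: p poly_0_coeff_0)
  moreover have "(\<Sum>m=1..n. sym_scalar ((-1) ^ (m + 1) / of_nat m) * fdiff m (\<lambda>x. poly p (of_nat x)) 0)
      = (\<Sum>m=1..n. (-1) ^ (m + 1) * (?d (m - 1) + ?d m))"
    by (intro sum.cong refl summand) simp
  ultimately show ?thesis using tele by simp
qed

text \<open>This is x(x-1)...(x-k+1)/k!; each step multiplies by (x-k)/(k+1).\<close>

primrec binomial_poly :: "nat \<Rightarrow> 'a::rat_vector sym poly"
  where
    "binomial_poly 0 = 1"
  | "binomial_poly (Suc k) =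
      binomial_poly k * [:sym_scalar (- of_nat k / of_nat (Suc k)), sym_scalar (1 / of_nat (Suc k)):]"

lemma degree_binomial_poly: "degree (binomial_poly k) \<le> k"
proof (induction k)
  case (Suc k)
  show ?case unfolding binomial_poly.simps
    by (rule order.trans[OF degree_mult_le], rule order.trans[OF add_mono[OF Suc degree_pCons_le]]) simp
qed simp

lemma poly_binomial_poly: "poly (binomial_poly k) (of_nat x) = sym_scalar (of_nat (x choose k))"
proof (induction k)
  case (Suc k)
  \<comment> \<open>The absorption identity, written without subtraction so that it also holds for
    \<open>x < k\<close>.\<close>
  have "Suc k * (x choose Suc k) + k * (x choose k) = x * (x choose k)"
  proof (cases "k \<le> x")
    case True
    have "Suc k * (x choose Suc k) = (x - k) * (x choose k)"
      by (simp only: binomial_absorption binomial_absorb_comp)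
    then show ?thesis using True by (simp only: add_mult_distrib[symmetric]) simp
  qed (simp add: binomial_eq_0)
  then have "of_nat (Suc k) * of_nat (x choose Suc k) + of_nat k * of_nat (x choose k)
      = (of_nat x * of_nat (x choose k) :: rat)"
    by (metis of_nat_add of_nat_mult)
  then have eq: "of_nat (x choose Suc k)
      = of_nat (x choose k) * (- of_nat k / of_nat (Suc k) + of_nat x * (1 / of_nat (Suc k)) :: rat)"
    by (simp add: divide_simps del: of_nat_Suc) (simp add: algebra_simps)
  show ?case
    unfolding binomial_poly.simps poly_mult Suc eq sym_scalar_mult sym_scalar_add
    by (simp del: of_nat_Suc)
qed simp

lemma coeff_0_binomial_poly: "coeff (binomial_poly (Suc k)) 0 = 0"
  by (induction k) (simp_all add: coeff_mult)

text \<open>As the constant term is zero, each new factor acts on the linear coefficient only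
  through its own constant term; up to sign these ratios telescope.\<close>

lemma coeff_1_binomial_poly:
  "coeff (binomial_poly (Suc k) :: 'a::rat_vector sym poly) 1 = sym_scalar ((-1) ^ k / (of_nat k + 1))"
proof (induction k)
  case (Suc k)
  have "coeff (binomial_poly (Suc (Suc k)) :: 'a sym poly) 1 = coeff (binomial_poly (Suc k)) 1
      * sym_scalar (- of_nat (Suc k) / of_nat (Suc (Suc k)))"
    unfolding binomial_poly.simps(2)[of "Suc k"]
    by (simp add: coeff_mult coeff_0_binomial_poly del: binomial_poly.simps of_nat_Suc)
  also have "\<dots> = sym_scalar ((-1) ^ k / (of_nat k + 1) * (- of_nat (Suc k) / of_nat (Suc (Suc k))))"
    by (simp only: Suc sym_scalar_mult)
  also have "(-1) ^ k / (of_nat k + 1) * (- of_nat (Suc k) / of_nat (Suc (Suc k)))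
      = ((-1) ^ Suc k / (of_nat (Suc k) + 1) :: rat)"
  proof -
    have "of_nat k + 1 \<noteq> (0 :: rat)" "of_nat k + 2 \<noteq> (0 :: rat)"
      using of_nat_neq_0[of k, where ?'a = rat] of_nat_neq_0[of "Suc k", where ?'a = rat]
      by (simp_all add: add.commute)
    then show ?thesis by (simp add: divide_simps) (simp add: algebra_simps)
  qed
  finally show ?case .
qed simp


section \<open>Exponential generating functions\<close>

definition egf :: "(nat \<Rightarrow> 'a::rat_vector sym) \<Rightarrow> 'a sym fps"
  where "egf g = Abs_fps (\<lambda>k. (1 / fact k) *\<^sub>Q g k)"

lemma of_nat_Suc_fact:
  "of_nat (Suc m) * ((1 / fact (Suc m)) *\<^sub>Q x) = (1 / fact m) *\<^sub>Q x" for x :: "'a::rat_vector sym"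
proof -
  have "of_nat (Suc m) * (1 / fact (Suc m)) = (1 / fact m :: rat)"
    by (simp add: fact_Suc del: of_nat_Suc)
  then show ?thesis
    by (simp only: scaleQ_sym_eq mult.assoc[symmetric] sym_scalar_of_nat[symmetric]
        sym_scalar_mult[symmetric])
qed

lemma fps_deriv_egf: "fps_deriv (egf g) = egf (\<lambda>k. g (Suc k))"
  by (rule fps_ext) (simp add: egf_def of_nat_Suc_fact del: of_nat_Suc fact_Suc)

text \<open>The conditional keeps every summand a product over the same index set, to which the
  induction hypothesis of the exponential formula applies.\<close>

lemma fps_deriv_prod:
  fixes F :: "'i \<Rightarrow> 'r::comm_ring_1 fps"
  assumes "finite I"
  shows "fps_deriv (\<Prod>i\<in>I. F i) = (\<Sum>k\<in>I. \<Prod>i\<in>I. if i = k then fps_deriv (F i) else F i)"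
  using assms
proof (induction I rule: finite_induct)
  case (insert j I)
  have "(\<Prod>i\<in>I. if i = j then fps_deriv (F i) else F i) = (\<Prod>i\<in>I. F i)"
    using insert(2) by (intro prod.cong) auto
  moreover have "(\<Sum>k\<in>I. \<Prod>i\<in>insert j I. if i = k then fps_deriv (F i) else F i)
      = (\<Sum>k\<in>I. F j * (\<Prod>i\<in>I. if i = k then fps_deriv (F i) else F i))"
    using insert(1,2) by (intro sum.cong refl) auto
  ultimately show ?case
    using insert by (simp add: sum_distrib_left)
qed simp

text \<open>
  The exponential formula, by induction on \<open>m\<close>: splitting off the block of the last position shifts
  the corresponding \<open>g i\<close>, which is differentiation of its generating function.
\<close>

lemma egf_prod_nth:
  assumes "finite I"
  shows "(1 / fact m) *\<^sub>Q (\<Sum>\<phi>\<in>{..<m} \<rightarrow>\<^sub>E I. \<Prod>i\<in>I. g i (card {j. j < m \<and> \<phi> j = i}))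
    = (\<Prod>i\<in>I. egf (g i)) $ m"
proof (induction m arbitrary: g)
  case 0
  have "(\<Prod>i\<in>I. egf (g i)) $ 0 = (\<Prod>i\<in>I. g i 0)"
    using assms by (induction I rule: finite_induct) (simp_all add: egf_def scaleQ_one)
  then show ?case by (simp add: scaleQ_one)
next
  case (Suc m)
  \<comment> \<open>\<open>g' k\<close> is the family that results when the last position joins
    block \<open>k\<close>, whose size then grows by one.\<close>
  define g' where "g' k i = (if i = k then \<lambda>l. g i (Suc l) else g i)" for k i
  have "fps_deriv (\<Prod>i\<in>I. egf (g i)) = (\<Sum>k\<in>I. \<Prod>i\<in>I. egf (g' k i))"
    unfolding fps_deriv_prod[OF assms] fps_deriv_egf g'_def
    by (intro sum.cong prod.cong refl) simp
  moreover have "fps_deriv (\<Prod>i\<in>I. egf (g i)) $ m = of_nat (Suc m) * (\<Prod>i\<in>I. egf (g i)) $ Suc m"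
    by simp
  ultimately have 1: "of_nat (Suc m) * (\<Prod>i\<in>I. egf (g i)) $ Suc m = (\<Sum>k\<in>I. (\<Prod>i\<in>I. egf (g' k i)) $ m)"
    by (simp only: fps_sum_nth)
  have card: "g i (card {j. j < Suc m \<and> (\<phi>(m := k)) j = i}) = g' k i (card {j. j < m \<and> \<phi> j = i})" for i k \<phi>
  proof -
    have "{j. j < Suc m \<and> (\<phi>(m := k)) j = i}
        = (if i = k then insert m {j. j < m \<and> \<phi> j = i} else {j. j < m \<and> \<phi> j = i})"
      by (auto simp: less_Suc_eq)
    then show ?thesis by (simp add: g'_def)
  qed
  have "(\<Sum>\<phi>\<in>{..<Suc m} \<rightarrow>\<^sub>E I. \<Prod>i\<in>I. g i (card {j. j < Suc m \<and> \<phi> j = i}))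
      = (\<Sum>(k, \<phi>)\<in>I \<times> ({..<m} \<rightarrow>\<^sub>E I). \<Prod>i\<in>I. g i (card {j. j < Suc m \<and> (\<phi>(m := k)) j = i}))"
    unfolding lessThan_Suc PiE_insert_eq
    by (subst sum.reindex[OF inj_combinator]) (simp_all add: case_prod_beta)
  also have "\<dots> = (\<Sum>k\<in>I. \<Sum>\<phi>\<in>{..<m} \<rightarrow>\<^sub>E I. \<Prod>i\<in>I. g' k i (card {j. j < m \<and> \<phi> j = i}))"
    unfolding card by (simp add: sum.cartesian_product)
  finally have 2: "(1 / fact m) *\<^sub>Q (\<Sum>\<phi>\<in>{..<Suc m} \<rightarrow>\<^sub>E I. \<Prod>i\<in>I. g i (card {j. j < Suc m \<and> \<phi> j = i}))
      = of_nat (Suc m) * (\<Prod>i\<in>I. egf (g i)) $ Suc m"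
    unfolding 1 by (simp only: rat_vector.scale_sum_right Suc[symmetric])
  have "(1 / fact (Suc m)) *\<^sub>Q x = (1 / of_nat (Suc m)) *\<^sub>Q (1 / fact m) *\<^sub>Q x" for x :: "'b sym"
    by (simp add: scaleQ_scaleQ field_simps)
  moreover have "(1 / of_nat (Suc m)) *\<^sub>Q (of_nat (Suc m) * x) = x" for x :: "'b sym"
    by (simp add: scaleQ_sym_eq mult.assoc[symmetric] sym_scalar_mult[symmetric] del: of_nat_Suc
        flip: sym_scalar_of_nat)
  ultimately show ?case by (simp only: 2)
qed


section \<open>The exponential series\<close>

text \<open>\<open>F ^ m\<close> starts in degree \<open>m\<close> or later, so one finite sum
  represents all coefficients up to \<open>N\<close>.\<close>

lemma sym_exp_nth:
  assumes F: "F $ 0 = 0" and "n \<le> N"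
  shows "sym_exp F $ n = (\<Sum>m\<le>N. fps_const (sym_scalar (1 / fact m)) * F ^ m) $ n"
proof -
  have "(\<Sum>m\<le>N. fps_const (sym_scalar (1 / fact m)) * F ^ m) $ n
      = (\<Sum>m\<le>N. sym_scalar (1 / fact m) * (F ^ m) $ n)"
    by (simp add: fps_sum_nth)
  also have "\<dots> = (\<Sum>m\<le>n. sym_scalar (1 / fact m) * (F ^ m) $ n)"
    using \<open>n \<le> N\<close> startsby_zero_power_prefix[OF F]
    by (intro sum.mono_neutral_right) auto
  finally show ?thesis by (simp add: sym_exp_def scaleQ_sym_eq)
qed

lemma sym_exp_add:
  assumes F: "F $ 0 = 0" and G: "G $ 0 = 0"
  shows "sym_exp (F + G) = sym_exp F * sym_exp G"
proof (rule fps_ext)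
  fix n
  let ?s = "\<lambda>m. sym_scalar (1 / fact m) :: 'a sym"
  let ?t = "\<lambda>j k. ?s j * ?s k * (F ^ j * G ^ k) $ n"
  have FG: "(F ^ j * G ^ k) $ n = 0" if "n < j + k" for j k
  proof -
    have "F ^ j $ i * G ^ k $ (n - i) = 0" if "i \<le> n" for i
    proof (cases "i < j")
      case False
      then have "n - i < k" using \<open>n < j + k\<close> that by linarith
      then show ?thesis using startsby_zero_power_prefix[OF G] by simp
    qed (use startsby_zero_power_prefix[OF F] in simp)
    then show ?thesis by (simp add: fps_mult_nth)
  qed
  have "(sym_exp F * sym_exp G) $ n
      = ((\<Sum>m\<le>n. fps_const (?s m) * F ^ m) * (\<Sum>m\<le>n. fps_const (?s m) * G ^ m)) $ n"
    by (simp add: fps_mult_nth sym_exp_nth[where N = n] F G)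
  also have "\<dots> = (\<Sum>j\<le>n. \<Sum>k\<le>n. (fps_const (?s j * ?s k) * (F ^ j * G ^ k)) $ n)"
    unfolding sum_product fps_sum_nth fps_const_mult[symmetric] by (simp only: mult_ac)
  also have "\<dots> = (\<Sum>(j, k)\<in>{..n} \<times> {..n}. ?t j k)"
    by (simp only: fps_mult_left_const_nth sum.cartesian_product)
  \<comment> \<open>Pairs with \<open>j + k > n\<close> do not reach degree \<open>n\<close>; the
    remaining triangle is then sliced along \<open>j + k = m\<close> for the binomial
    theorem.\<close>
  also have "\<dots> = (\<Sum>(j, k)\<in>{(j, k). j + k \<le> n}. ?t j k)"
    by (rule sum.mono_neutral_right) (auto, metis FG mult_zero_right not_le)
  also have "\<dots> = (\<Sum>m\<le>n. \<Sum>j\<le>m. ?t j (m - j))"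
    by (rule sum.triangle_reindex_eq)
  also have "\<dots> = (\<Sum>m\<le>n. ?s m * ((F + G) ^ m) $ n)"
  proof (intro sum.cong refl)
    fix m
    have "?s j * ?s (m - j) = ?s m * of_nat (m choose j)" if "j \<le> m" for j
    proof -
      have "1 / fact j * (1 / fact (m - j)) = (1 / fact m * of_nat (m choose j) :: rat)"
        using binomial_fact[OF that, where ?'a = rat] by simp
      then show ?thesis by (metis sym_scalar_mult sym_scalar_of_nat)
    qed
    then show "(\<Sum>j\<le>m. ?t j (m - j)) = ?s m * ((F + G) ^ m) $ n"
      unfolding binomial_ring fps_sum_nth sum_distrib_left
      by (intro sum.cong refl) (simp add: fps_of_nat[symmetric] mult.assoc)
  qed
  also have "\<dots> = sym_exp (F + G) $ n"
    by (simp add: sym_exp_def scaleQ_sym_eq)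
  finally show "sym_exp (F + G) $ n = (sym_exp F * sym_exp G) $ n" ..
qed


section \<open>Right multiplication by the exponential\<close>

text \<open>Reduces additive claims to scaled products of elements of N, where
  \<open>star_word\<close> computes the product.\<close>

lemma sym_monomial_induct [case_names monomial add]:
  fixes x :: "'a::rat_vector sym"
  assumes monomial: "\<And>c ws. P (c *\<^sub>Q (\<Prod>w\<leftarrow>ws. sym_of w))"
    and add: "\<And>x y. P x \<Longrightarrow> P y \<Longrightarrow> P (x + y)"
  shows "P x"
proof -
  have "P (abs_sym p)" for p
  proof (induction p rule: poly_mapping_monomial_induct)
    case (single M c)
    obtain ws where "M = mset ws" using ex_mset by metis
    then have "abs_sym (Poly_Mapping.single M c) = c *\<^sub>Q (\<Prod>w\<leftarrow>ws. sym_of w)"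
      by (simp add: prod_list_sym_of scaleQ_sym.abs_eq mult_single)
    then show ?case using monomial by simp
  next
    case (add p q)
    then show ?case using assms(2) by (simp add: plus_sym.abs_eq[symmetric])
  qed
  then show ?thesis by (metis Quotient3_abs_rep[OF Quotient3_sym])
qed

lemma prod_list_prod_nth: "(\<Prod>x\<leftarrow>xs. h x) = (\<Prod>i<length xs. h (xs ! i))"
  for h :: "'a \<Rightarrow> 'b::comm_monoid_mult"
  by (induction xs rule: rev_induct) (simp_all add: nth_append)

lemma nths_replicate: "nths (replicate m x) A = replicate (card {j. j < m \<and> j \<in> A}) x"
proof (rule replicate_eqI)
  show "length (nths (replicate m x) A) = card {j. j < m \<and> j \<in> A}"
    by (simp add: length_nths)
  show "y = x" if "y \<in> set (nths (replicate m x) A)" for y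
    using that set_nths_subset[of "replicate m x" A] by auto
qed

definition sym_series :: "(nat \<Rightarrow> 'a::rat_vector) \<Rightarrow> 'a sym fps"
  where "sym_series u = Abs_fps (\<lambda>n. sym_of (u n))"

lemmas sym_of_add = linearQ_sym_of[unfolded linearQ_iff, THEN conjunct1, rule_format]
  and sym_of_scale = linearQ_sym_of[unfolded linearQ_iff, THEN conjunct2, rule_format]

lemma sym_of_0 [simp]: "sym_of 0 = 0"
  using sym_of_add[of 0 0] by simp

lemma sym_of_sum: "sym_of (\<Sum>i\<in>I. h i) = (\<Sum>i\<in>I. sym_of (h i))"
  by (induction I rule: infinite_finite_induct) (simp_all add: sym_of_add)

context novikov_algebra
begin

context
  fixes f :: 'a
begin

definition exp_series :: "'a sym fps"
  where "exp_series = sym_exp (fps_const (sym_of f) * fps_X)"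

text \<open>\<open>exp_brace w\<close> is \<open>w{exp(\<lambda> f)}\<close>, and \<open>brace_series u\<close> is its extension to \<open>u \<in> N[[\<lambda>]]\<close>.\<close>

definition exp_brace :: "'a \<Rightarrow> 'a sym fps"
  where "exp_brace w = egf (\<lambda>k. sym_of (brace (\<triangleleft>) w (replicate k f)))"

definition brace_series :: "(nat \<Rightarrow> 'a) \<Rightarrow> nat \<Rightarrow> 'a"
  where "brace_series u n = (\<Sum>i\<le>n. (1 / fact (n - i)) *\<^sub>Q brace (\<triangleleft>) (u i) (replicate (n - i) f))"

definition star_exp :: "'a sym \<Rightarrow> 'a sym fps"
  where "star_exp x = Abs_fps (\<lambda>m. star (\<triangleleft>) x (exp_series $ m))"

lemma exp_series_egf: "exp_series = egf (\<lambda>k. sym_of f ^ k)"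
proof (rule fps_ext)
  fix n
  have "((fps_const (sym_of f) * fps_X) ^ m) $ n = (if m = n then sym_of f ^ m else 0)" for m
    by (auto simp: power_mult_distrib fps_const_power fps_X_power_nth)
  then show "exp_series $ n = egf (\<lambda>k. sym_of f ^ k) $ n"
    by (simp add: exp_series_def sym_exp_def egf_def if_distrib[where f = "scaleQ _"] cong: if_cong)
qed

text \<open>All inserted letters equal \<open>f\<close>, so a summand depends only on block sizes
  and the exponential formula applies. The extra block, inserted in no brace, yields
  \<open>exp_series\<close>.\<close>

lemma star_word_replicate:
  "(1 / fact m) *\<^sub>Q star_word (\<triangleleft>) ws (replicate m f)
    = ((\<Prod>w\<leftarrow>ws. exp_brace w) * exp_series) $ m"
proof -
  define g where "g i = (if i < length ws then (\<lambda>k. sym_of (brace (\<triangleleft>) (ws ! i) (replicate k f)))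
    else (\<lambda>k. sym_of f ^ k))" for i
  have "star_word (\<triangleleft>) ws (replicate m f)
      = (\<Sum>\<phi>\<in>{..<m} \<rightarrow>\<^sub>E {..length ws}. \<Prod>i\<le>length ws. g i (card {j. j < m \<and> \<phi> j = i}))"
    by (simp add: star_word_def g_def nths_replicate lessThan_Suc_atMost[symmetric])
  then have "(1 / fact m) *\<^sub>Q star_word (\<triangleleft>) ws (replicate m f) = (\<Prod>i\<le>length ws. egf (g i)) $ m"
    by (simp add: egf_prod_nth)
  also have "(\<Prod>i\<le>length ws. egf (g i)) = (\<Prod>i<length ws. exp_brace (ws ! i)) * exp_series"
    by (simp add: lessThan_Suc_atMost[symmetric] g_def exp_brace_def exp_series_egf)
  also have "(\<Prod>i<length ws. exp_brace (ws ! i)) = (\<Prod>w\<leftarrow>ws. exp_brace w)"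
    by (simp add: prod_list_prod_nth)
  finally show ?thesis .
qed

lemma star_exp_monomial:
  "star_exp (\<Prod>w\<leftarrow>ws. sym_of w) = (\<Prod>w\<leftarrow>ws. exp_brace w) * exp_series"
proof (rule fps_ext)
  fix m
  have "sym_of f ^ m = (\<Prod>z\<leftarrow>replicate m f. sym_of z)"
    by (simp add: map_replicate)
  then have "star (\<triangleleft>) (\<Prod>w\<leftarrow>ws. sym_of w) (sym_of f ^ m) = star_word (\<triangleleft>) ws (replicate m f)"
    by (simp only: star_monomials)
  then have "star_exp (\<Prod>w\<leftarrow>ws. sym_of w) $ m = (1 / fact m) *\<^sub>Q star_word (\<triangleleft>) ws (replicate m f)"
    using linearQ_star_right by (simp add: star_exp_def exp_series_egf egf_def linearQ_iff)
  then show "star_exp (\<Prod>w\<leftarrow>ws. sym_of w) $ m = ((\<Prod>w\<leftarrow>ws. exp_brace w) * exp_series) $ m"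
    by (simp only: star_word_replicate)
qed

lemma star_exp_add: "star_exp (x + y) = star_exp x + star_exp y"
  using linearQ_star_left by (intro fps_ext) (simp add: star_exp_def linearQ_iff)

lemma star_exp_scale: "star_exp (c *\<^sub>Q x) = fps_const (sym_scalar c) * star_exp x"
  using linearQ_star_left by (intro fps_ext) (simp add: star_exp_def linearQ_iff scaleQ_sym_eq)

lemma star_exp_0 [simp]: "star_exp 0 = 0"
  using star_exp_add[of 0 0] by simp

lemma star_exp_sum: "star_exp (\<Sum>i\<in>I. h i) = (\<Sum>i\<in>I. star_exp (h i))"
  by (induction I rule: infinite_finite_induct) (simp_all add: star_exp_add)

text \<open>On monomials \<open>star_exp\<close> has one factor per letter besides the common
  \<open>exp_series\<close>, so a letter can be peeled off; linearity does the rest.\<close>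

lemma star_exp_mult: "star_exp (sym_of w * x) = exp_brace w * star_exp x"
proof (induction x rule: sym_monomial_induct)
  case (monomial c ws)
  show ?case
    using star_exp_monomial[of "w # ws"]
    by (simp add: scaleQ_sym_mult_right star_exp_scale star_exp_monomial mult_ac)
qed (simp add: distrib_left star_exp_add)

lemma star_fps_exp_nth:
  "star_fps (\<triangleleft>) G exp_series $ n = (\<Sum>i\<le>n. star_exp (G $ i) $ (n - i))"
  by (simp add: star_fps_def star_exp_def)

lemma sym_series_brace_series_nth:
  "sym_series (brace_series u) $ n = (\<Sum>i\<le>n. exp_brace (u i) $ (n - i))"
  by (simp add: sym_series_def brace_series_def exp_brace_def egf_def sym_of_sum sym_of_scale)

lemma star_fps_exp_mult:
  "star_fps (\<triangleleft>) (sym_series u * G) exp_series = sym_series (brace_series u) * star_fps (\<triangleleft>) G exp_series"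
proof (rule fps_ext)
  fix n
  let ?h = "\<lambda>l p r q. exp_brace (u l) $ p * star_exp (G $ r) $ q"
  have "star_fps (\<triangleleft>) (sym_series u * G) exp_series $ n
      = (\<Sum>i\<le>n. \<Sum>l\<le>i. \<Sum>p\<le>n - i. ?h l p (i - l) (n - i - p))"
    by (simp add: star_fps_exp_nth fps_mult_nth star_exp_sum fps_sum_nth star_exp_mult sym_series_def
        atLeast0AtMost)
  also have "\<dots> = (\<Sum>(i, l, p)\<in>(SIGMA i:{..n}. {..i} \<times> {..n - i}). ?h l p (i - l) (n - i - p))"
    by (simp add: sum.Sigma sum.cartesian_product)
  \<comment> \<open>Regroup by \<open>s = l + p\<close>, the degree contributed by the brace series,
    and \<open>r = i - l\<close>, the degree taken from \<open>G\<close>.\<close>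
  also have "\<dots> = (\<Sum>(s, l, r)\<in>(SIGMA s:{..n}. {..s} \<times> {..n - s}). ?h l (s - l) r (n - s - r))"
    by (rule sum.reindex_bij_witness[where i = "\<lambda>(s, l, r). (l + r, l, s - l)"
          and j = "\<lambda>(i, l, p). (l + p, l, i - l)"])
      (auto simp: algebra_simps)
  also have "\<dots> = (\<Sum>s\<le>n. \<Sum>l\<le>s. \<Sum>r\<le>n - s. ?h l (s - l) r (n - s - r))"
    by (simp add: sum.Sigma sum.cartesian_product)
  also have "\<dots> = (sym_series (brace_series u) * star_fps (\<triangleleft>) G exp_series) $ n"
    by (simp add: fps_mult_nth sym_series_brace_series_nth star_fps_exp_nth sum_product atLeast0AtMost)
  finally show "star_fps (\<triangleleft>) (sym_series u * G) exp_series $ n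
      = (sym_series (brace_series u) * star_fps (\<triangleleft>) G exp_series) $ n" .
qed

lemma star_fps_one_exp: "star_fps (\<triangleleft>) 1 exp_series = exp_series"
proof (rule fps_ext)
  fix n
  have "star_fps (\<triangleleft>) 1 exp_series $ n = (\<Sum>i\<in>{0}. star_exp (1 $ i) $ (n - i))"
    unfolding star_fps_exp_nth by (rule sum.mono_neutral_right) auto
  then show "star_fps (\<triangleleft>) 1 exp_series $ n = exp_series $ n"
    using star_exp_monomial[of "[]"] by simp
qed

lemma star_fps_exp_power:
  "star_fps (\<triangleleft>) (sym_series u ^ j) exp_series = sym_series (brace_series u) ^ j * exp_series"
  by (induction j) (simp_all add: star_fps_one_exp star_fps_exp_mult mult.assoc)

text \<open>Each power of the exponent is transformed by T and leaves one factor
  \<open>exp_series\<close>, which merges into the exponential. Thus the exponent a becomes T a +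
  \<lambda> f.\<close>

lemma star_fps_sym_exp:
  assumes "u 0 = 0"
  shows "star_fps (\<triangleleft>) (sym_exp (sym_series u)) exp_series
    = sym_exp (sym_series (brace_series u) + fps_const (sym_of f) * fps_X)"
proof -
  let ?F = "sym_series u" and ?G = "sym_series (brace_series u)"
  have 0: "?F $ 0 = 0" "?G $ 0 = 0"
    using assms by (simp_all add: sym_series_def brace_series_def scaleQ_one)
  have "star_fps (\<triangleleft>) (sym_exp ?F) exp_series $ n = (sym_exp ?G * exp_series) $ n" for n
  proof -
    let ?s = "\<lambda>m. sym_scalar (1 / fact m) :: 'a sym"
    have "star_fps (\<triangleleft>) (sym_exp ?F) exp_series $ n
        = (\<Sum>i\<le>n. star_exp (\<Sum>m\<le>n. (1 / fact m) *\<^sub>Q (?F ^ m) $ i) $ (n - i))"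
      by (simp add: star_fps_exp_nth sym_exp_nth[OF 0(1), where N = n] fps_sum_nth scaleQ_sym_eq)
    also have "\<dots> = (\<Sum>m\<le>n. ?s m * star_fps (\<triangleleft>) (?F ^ m) exp_series $ n)"
      unfolding star_fps_exp_nth star_exp_sum star_exp_scale fps_sum_nth sum_distrib_left
      by (subst sum.swap) simp
    also have "\<dots> = ((\<Sum>m\<le>n. fps_const (?s m) * ?G ^ m) * exp_series) $ n"
      by (simp add: star_fps_exp_power sum_distrib_right fps_sum_nth mult.assoc)
    also have "\<dots> = (sym_exp ?G * exp_series) $ n"
      by (simp add: fps_mult_nth sym_exp_nth[OF 0(2), where N = n])
    finally show ?thesis .
  qed
  then show ?thesis by (simp add: fps_eq_iff sym_exp_add 0 exp_series_def)
qed


text \<open>With \<open>T v = v{exp(\<lambda> f)}\<close>, this is \<open>T - 1\<close>.\<close>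

definition brace_diff :: "(nat \<Rightarrow> 'a) \<Rightarrow> nat \<Rightarrow> 'a"
  where "brace_diff u n = (\<Sum>i<n. (1 / fact (n - i)) *\<^sub>Q brace (\<triangleleft>) (u i) (replicate (n - i) f))"

text \<open>The initial sequence is \<lambda> f, so this is (T - 1)^k (\<lambda> f).\<close>

definition iterated_brace :: "nat \<Rightarrow> nat \<Rightarrow> 'a"
  where "iterated_brace k = (brace_diff ^^ k) (\<lambda>n. if n = 1 then f else 0)"

text \<open>The Newton expansion of \<open>(1 + T + \<dots> + T\<^sup>x\<^sup>-\<^sup>1) (\<lambda> f)\<close> as a function of \<open>x\<close>.\<close>

definition newton_series :: "nat \<Rightarrow> nat \<Rightarrow> 'a"
  where "newton_series x n = (\<Sum>k<n. of_nat (x choose Suc k) *\<^sub>Q iterated_brace k n)"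

section \<open>Truncation and recursion of the Newton series\<close>

lemma brace_series_diff: "brace_series u n = brace_diff u n + u n"
  by (simp add: brace_series_def brace_diff_def lessThan_Suc_atMost[symmetric] scaleQ_one)

lemma brace_zero_left [simp]: "brace (\<triangleleft>) 0 ws = 0"
  using linearQ_brace_left[of ws] rat_vector.scale_zero_left unfolding linearQ_iff by metis

lemma brace_scale_left: "brace (\<triangleleft>) (c *\<^sub>Q v) ws = c *\<^sub>Q brace (\<triangleleft>) v ws"
  using linearQ_brace_left[of ws] unfolding linearQ_iff by blast

lemma brace_sum_left: "brace (\<triangleleft>) (\<Sum>i\<in>I. h i) ws = (\<Sum>i\<in>I. brace (\<triangleleft>) (h i) ws)"
  using linearQ_brace_left[of ws]
  by (induction I rule: infinite_finite_induct) (simp_all add: linearQ_iff)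

lemma iterated_brace_0: "iterated_brace 0 n = (if n = 1 then f else 0)"
  by (simp add: iterated_brace_def)

lemma iterated_brace_Suc: "iterated_brace (Suc k) = brace_diff (iterated_brace k)"
  by (simp add: iterated_brace_def)

text \<open>T - 1 drops the empty brace and so raises the lowest degree, which is 1 at the start.
  Hence cutting \<open>newton_series\<close> at \<open>k < n\<close> loses nothing.\<close>

lemma iterated_brace_eq_0: "n \<le> k \<Longrightarrow> iterated_brace k n = 0"
proof (induction k arbitrary: n)
  case (Suc k)
  then show ?case by (simp add: iterated_brace_Suc brace_diff_def)
qed (simp add: iterated_brace_0)

lemma newton_series_extend:
  assumes "n \<le> N"
  shows "newton_series x n = (\<Sum>k<N. of_nat (x choose Suc k) *\<^sub>Q iterated_brace k n)"
  unfolding newton_series_def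
  using assms by (intro sum.mono_neutral_left) (auto simp: iterated_brace_eq_0)

lemma brace_diff_newton_series:
  "brace_diff (newton_series x) n = (\<Sum>k<n. of_nat (x choose Suc k) *\<^sub>Q iterated_brace (Suc k) n)"
proof -
  have "brace_diff (newton_series x) n = (\<Sum>i<n. \<Sum>k<n. (1 / fact (n - i)) *\<^sub>Q
      of_nat (x choose Suc k) *\<^sub>Q brace (\<triangleleft>) (iterated_brace k i) (replicate (n - i) f))"
    by (simp add: brace_diff_def newton_series_extend[where N = n] brace_sum_left brace_scale_left
        rat_vector.scale_sum_right)
  also have "\<dots> = (\<Sum>k<n. of_nat (x choose Suc k) *\<^sub>Q iterated_brace (Suc k) n)"
    by (subst sum.swap)
      (simp add: iterated_brace_Suc brace_diff_def rat_vector.scale_sum_right mult.commute)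
  finally show ?thesis .
qed

text \<open>Pascal's rule splits the sum into the old series and a shifted one; the latter is
  \<lambda> f plus T - 1 applied to the old series.\<close>

lemma newton_series_Suc:
  "newton_series (Suc x) n = brace_series (newton_series x) n + (if n = 1 then f else 0)"
proof -
  have "(\<Sum>k<n. of_nat (x choose k) *\<^sub>Q iterated_brace k n)
      = (\<Sum>k<Suc n. of_nat (x choose k) *\<^sub>Q iterated_brace k n)"
    by (simp add: iterated_brace_eq_0)
  also have "\<dots> = iterated_brace 0 n + brace_diff (newton_series x) n"
    unfolding sum.lessThan_Suc_shift brace_diff_newton_series by (simp add: scaleQ_one)
  finally show ?thesis
    by (simp add: newton_series_def[of "Suc x"] newton_series_def[of x n] scaleQ_add_left sum.distrib
        brace_series_diff iterated_brace_0)
qed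

section \<open>Star-powers of the exponential and their differences\<close>

lemma star_power_exp_series: "star_power (\<triangleleft>) exp_series x = sym_exp (sym_series (newton_series x))"
proof (induction x)
  case 0
  have "sym_series (newton_series 0) = 0"
    by (simp add: fps_eq_iff sym_series_def newton_series_def)
  moreover have "sym_exp 0 = (1 :: 'a sym fps)"
    by (rule fps_ext, subst sym_exp_nth[OF _ order.refl])
      (simp_all add: power_0_left if_distrib[where f = "(*) _"] cong: if_cong)
  ultimately show ?case by simp
next
  case (Suc x)
  have "sym_series (newton_series (Suc x))
      = sym_series (brace_series (newton_series x)) + fps_const (sym_of f) * fps_X"
    by (simp add: fps_eq_iff sym_series_def newton_series_Suc sym_of_add)
  moreover have "newton_series x 0 = 0" by (simp add: newton_series_def)
  ultimately show ?case using Suc by (simp add: star_fps_sym_exp)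
qed

lemma star_one_right: "star (\<triangleleft>) x 1 = x"
proof (induction x rule: sym_monomial_induct)
  case (monomial c ws)
  have "star (\<triangleleft>) (\<Prod>w\<leftarrow>ws. sym_of w) (\<Prod>z\<leftarrow>[]. sym_of z) = (\<Prod>w\<leftarrow>ws. sym_of w)"
    unfolding star_monomials by (simp add: star_word_def prod_list_prod_nth)
  then show ?case using linearQ_star_left[of 1] by (simp add: linearQ_iff)
next
  case (add x y)
  then show ?case using linearQ_star_left[of 1] by (simp add: linearQ_iff)
qed

lemma star_fps_diff_one: "star_fps (\<triangleleft>) G (F - 1) = star_fps (\<triangleleft>) G F - G"
proof (rule fps_ext)
  fix n
  have diff: "star (\<triangleleft>) x (y - z) = star (\<triangleleft>) x y - star (\<triangleleft>) x z" for x y z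
    using linearQ_star_right[of x] unfolding linearQ_iff by (metis add_diff_cancel_right' diff_add_cancel)
  have "(\<Sum>i\<le>n. star (\<triangleleft>) (G $ i) ((1 :: 'a sym fps) $ (n - i))) = (\<Sum>i\<in>{n}. star (\<triangleleft>) (G $ i) (1 $ (n - i)))"
    using diff[of _ 0 0] by (intro sum.mono_neutral_right) auto
  then show "star_fps (\<triangleleft>) G (F - 1) $ n = (star_fps (\<triangleleft>) G F - G) $ n"
    by (simp add: star_fps_def diff sum_subtractf star_one_right)
qed

text \<open>
  Right multiplication by \<open>F - 1\<close> is right multiplication by \<open>F\<close> minus the identity, so it acts on
  the powers of \<open>F\<close> as the difference operator.
\<close>

lemma star_power_diff_one: "star_power (\<triangleleft>) (F - 1) m = fdiff m (star_power (\<triangleleft>) F) 0"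
proof -
  let ?R = "\<lambda>G. star_fps (\<triangleleft>) G (F - 1)"
  have diff: "(?R ^^ m) (G - H) = (?R ^^ m) G - (?R ^^ m) H" for m G H
  proof (induction m)
    case (Suc m)
    have "star (\<triangleleft>) (x - y) z = star (\<triangleleft>) x z - star (\<triangleleft>) y z" for x y z
      using linearQ_star_left[of z] unfolding linearQ_iff by (metis add_diff_cancel_right' diff_add_cancel)
    then have "?R (G - H) = ?R G - ?R H" for G H
      by (simp add: fps_eq_iff star_fps_def sum_subtractf)
    then show ?case using Suc by simp
  qed simp
  \<comment> \<open>The starting power \<open>x\<close> is arbitrary because the induction step also
    uses \<open>Suc x\<close>.\<close>
  have "(?R ^^ m) (star_power (\<triangleleft>) F x) = fdiff m (star_power (\<triangleleft>) F) x" for m x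
  proof (induction m arbitrary: x)
    case (Suc m)
    have "(?R ^^ Suc m) (star_power (\<triangleleft>) F x)
        = (?R ^^ m) (star_power (\<triangleleft>) F (Suc x) - star_power (\<triangleleft>) F x)"
      by (simp only: funpow_Suc_right o_apply star_fps_diff_one star_power.simps)
    then show ?case by (simp only: diff Suc fdiff.simps)
  qed simp
  moreover have "star_power (\<triangleleft>) (F - 1) m = (?R ^^ m) 1" for m
    by (induction m) simp_all
  ultimately show ?thesis by (metis star_power.simps(1))
qed

text \<open>The Newton series with \<open>x\<close> replaced by a polynomial indeterminate.\<close>

definition newton_poly :: "'a sym poly fps"
  where "newton_poly = Abs_fps (\<lambda>n. \<Sum>k<n. smult (sym_of (iterated_brace k n)) (binomial_poly (Suc k)))"

lemma poly_newton_poly_power: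
  "poly ((newton_poly ^ j) $ n) (of_nat x) = (sym_series (newton_series x) ^ j) $ n"
proof (induction j arbitrary: n)
  case (Suc j)
  have "poly (newton_poly $ n) (of_nat x) = sym_series (newton_series x) $ n" for n
    by (simp add: newton_poly_def sym_series_def newton_series_def poly_sum poly_binomial_poly
        sym_of_sum sym_of_scale scaleQ_sym_eq mult.commute del: binomial_poly.simps binomial_Suc_Suc sym_scalar_of_nat)
  then show ?case by (simp add: fps_mult_nth poly_sum Suc)
qed simp

text \<open>The degree in \<open>x\<close> is bounded by the degree in \<lambda>, which is what lets
  the logarithm stop at \<open>m = n\<close>.\<close>

lemma degree_newton_poly_power: "degree ((newton_poly ^ j) $ n) \<le> n"
proof (induction j arbitrary: n)
  case (Suc j)
  have A: "degree (newton_poly $ n) \<le> n" for n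
    unfolding newton_poly_def fps_nth_Abs_fps
    by (rule degree_sum_le)
      (auto intro!: order.trans[OF degree_smult_le] order.trans[OF degree_binomial_poly] simp del: binomial_poly.simps)
  show ?case
    unfolding power_Suc fps_mult_nth
  proof (rule degree_sum_le)
    fix i assume i: "i \<in> {0..n}"
    show "degree (newton_poly $ i * (newton_poly ^ j) $ (n - i)) \<le> n"
      by (rule order.trans[OF degree_mult_le], rule order.trans[OF add_mono[OF A Suc]]) (use i in auto)
  qed simp
qed simp

lemma coeff_0_newton_poly: "coeff (newton_poly $ n) 0 = 0"
  by (simp add: newton_poly_def coeff_sum coeff_0_binomial_poly del: binomial_poly.simps)

text \<open>The coefficients vanish at x = 0, so those of a square or higher power vanish there to
  second order.\<close>

lemma coeff_1_newton_poly_power: "coeff ((newton_poly ^ j) $ n) 1 = (if j = 1 then coeff (newton_poly $ n) 1 else 0)"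
proof -
  have 1: "coeff ((newton_poly ^ Suc i) $ n) 0 = 0" for i n
    by (simp add: fps_mult_nth coeff_sum coeff_mult coeff_0_newton_poly)
  have "coeff ((newton_poly ^ Suc (Suc i)) $ n) 1 = 0" for i
    unfolding power_Suc[of _ "Suc i"] fps_mult_nth coeff_sum
    by (simp add: coeff_mult coeff_0_newton_poly 1 del: power_Suc)
  then have "coeff ((newton_poly ^ j) $ n) 1 = 0" if "2 \<le> j"
    using that by (metis Suc_le_D numeral_2_eq_2 Suc_le_mono)
  moreover have "j = 0 \<or> j = 1 \<or> 2 \<le> j" by linarith
  ultimately show ?thesis by (auto simp: fps_one_nth)
qed

section \<open>The logarithm and its expansion over compositions\<close>

lemma prelie_log_nth:
  "prelie_log (\<triangleleft>) f $ n = sym_of (\<Sum>k<n. ((-1) ^ k / (of_nat k + 1)) *\<^sub>Q iterated_brace k n)"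
proof -
  let ?s = "\<lambda>m. sym_scalar (1 / fact m) :: 'a sym"
  define P where "P = (\<Sum>j\<le>n. smult (?s j) ((newton_poly ^ j) $ n))"
  have P: "star_power (\<triangleleft>) exp_series x $ n = poly P (of_nat x)" for x
    by (simp add: star_power_exp_series P_def poly_sum poly_newton_poly_power sym_exp_def scaleQ_sym_eq)
  have "prelie_log (\<triangleleft>) f $ n
      = (\<Sum>m=1..n. sym_scalar ((-1) ^ (m + 1) / of_nat m) * fdiff m (\<lambda>x. poly P (of_nat x)) 0)"
    by (simp add: prelie_log_def exp_series_def[symmetric] star_log_def star_power_diff_one
        fdiff_fps_nth P scaleQ_sym_eq)
  also have "\<dots> = coeff P 1"
    unfolding P_def
    by (intro log_fdiff_poly degree_sum_le order.trans[OF degree_smult_le degree_newton_poly_power]) simp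
  also have "\<dots> = coeff (newton_poly $ n) 1"
  proof (cases n)
    \<comment> \<open>Here the sum in \<open>P\<close> has no term \<open>j = 1\<close>, but
      \<open>newton_poly $ 0\<close> is zero as an empty sum.\<close>
    case 0
    then show ?thesis by (simp add: P_def newton_poly_def)
  next
    case (Suc m)
    have "coeff P 1 = (\<Sum>j\<le>n. if j = 1 then coeff (newton_poly $ n) 1 else 0)"
      unfolding P_def coeff_sum coeff_smult coeff_1_newton_poly_power by (intro sum.cong) auto
    then show ?thesis using Suc by simp
  qed
  also have "\<dots> = sym_of (\<Sum>k<n. ((-1) ^ k / (of_nat k + 1)) *\<^sub>Q iterated_brace k n)"
    unfolding newton_poly_def fps_nth_Abs_fps coeff_sum coeff_smult coeff_1_binomial_poly
    by (simp add: sym_of_sum sym_of_scale scaleQ_sym_eq mult.commute)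
  finally show ?thesis .
qed

text \<open>Each application of T - 1 appends one part, positive because the empty brace is dropped.
  The initial \<open>f\<close> accounts for one degree, hence \<open>Suc n\<close> against
  \<open>n\<close>.\<close>

lemma iterated_brace_compositions:
  "iterated_brace i (Suc n) = (\<Sum>ks\<in>compositions n i. (1 / (\<Prod>k\<leftarrow>ks. fact k)) *\<^sub>Q
    foldl (\<lambda>x k. brace (\<triangleleft>) x (replicate k f)) f ks)"
proof (induction i arbitrary: n)
  case 0
  have "compositions n 0 = (if n = 0 then {[]} else {})"
    by (auto simp: compositions_def)
  then show ?case by (simp add: iterated_brace_0 scaleQ_one)
next
  case (Suc i)
  let ?c = "\<lambda>ks. 1 / (\<Prod>k\<leftarrow>ks. fact k) :: rat"
  let ?b = "foldl (\<lambda>x k. brace (\<triangleleft>) x (replicate k f)) f"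
  have "iterated_brace (Suc i) (Suc n)
      = (\<Sum>j<n. (1 / fact (n - j)) *\<^sub>Q brace (\<triangleleft>) (iterated_brace i (Suc j)) (replicate (n - j) f))"
    unfolding iterated_brace_Suc brace_diff_def sum.lessThan_Suc_shift by (simp add: iterated_brace_eq_0)
  also have "\<dots> = (\<Sum>j<n. \<Sum>ks\<in>compositions j i. ?c (ks @ [n - j]) *\<^sub>Q ?b (ks @ [n - j]))"
    by (simp add: Suc brace_sum_left brace_scale_left rat_vector.scale_sum_right mult.commute)
  also have "\<dots> = (\<Sum>(j, ks)\<in>(SIGMA j:{..<n}. compositions j i). ?c (ks @ [n - j]) *\<^sub>Q ?b (ks @ [n - j]))"
    by (simp add: sum.Sigma finite_compositions)
  also have "\<dots> = (\<Sum>ks\<in>compositions n (Suc i). ?c ks *\<^sub>Q ?b ks)"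
  proof (rule sum.reindex_bij_witness[where i = "\<lambda>ks. (sum_list (butlast ks), butlast ks)"
        and j = "\<lambda>(j, ks). ks @ [n - j]"])
    fix ks assume "ks \<in> compositions n (Suc i)"
    then obtain ls k where "ks = ls @ [k]" "length ls = i" "\<forall>k\<in>set ls. 0 < k" "0 < k" "sum_list ls + k = n"
      unfolding compositions_def by (cases ks rule: rev_cases) auto
    then show "(sum_list (butlast ks), butlast ks) \<in> (SIGMA j:{..<n}. compositions j i)"
      and "(case (sum_list (butlast ks), butlast ks) of (j, ks) \<Rightarrow> ks @ [n - j]) = ks"
      by (auto simp: compositions_def)
  qed (auto simp: compositions_def)
  finally show ?case .
qed

theorem prelie_log_compositions:
  "prelie_log (\<triangleleft>) f = fps_const (sym_of f) * fps_X + Abs_fps (\<lambda>n. if n < 2 then 0 else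
    sym_of (\<Sum>i=1..n - 1. ((-1) ^ i / (of_nat i + 1)) *\<^sub>Q
      (\<Sum>ks\<in>compositions (n - 1) i. (1 / (\<Prod>k\<leftarrow>ks. fact k)) *\<^sub>Q
        foldl (\<lambda>x k. brace (\<triangleleft>) x (replicate k f)) f ks)))"
proof (rule fps_ext)
  fix n
  consider "n = 0" | "n = 1" | m where "n = Suc (Suc m)"
    by (metis One_nat_def not0_implies_Suc)
  then show "prelie_log (\<triangleleft>) f $ n = (fps_const (sym_of f) * fps_X + Abs_fps (\<lambda>n. if n < 2 then 0 else
    sym_of (\<Sum>i=1..n - 1. ((-1) ^ i / (of_nat i + 1)) *\<^sub>Q
      (\<Sum>ks\<in>compositions (n - 1) i. (1 / (\<Prod>k\<leftarrow>ks. fact k)) *\<^sub>Q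
        foldl (\<lambda>x k. brace (\<triangleleft>) x (replicate k f)) f ks)))) $ n"
  proof cases
    case 3
    \<comment> \<open>The term \<open>k = 0\<close> is \<lambda> f and lives only in degree
      1.\<close>
    have "{..<n} = insert 0 {1..n - 1}" using 3 by auto
    then have "prelie_log (\<triangleleft>) f $ n = sym_of (\<Sum>i=1..n - 1. ((-1) ^ i / (of_nat i + 1)) *\<^sub>Q iterated_brace i n)"
      using 3 by (simp add: prelie_log_nth iterated_brace_0)
    then show ?thesis using 3 by (simp add: iterated_brace_compositions)
  qed (simp_all add: prelie_log_nth iterated_brace_0 scaleQ_one)
qed

end

end


section \<open>Braces in an algebra with derivation\<close>

lemma foldl_mult_right: "foldl (*) (x * y) ws = foldl (*) x ws * y"
  for x :: "'a::ab_semigroup_mult"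
proof (induction ws arbitrary: x)
  case (Cons w ws)
  have "x * y * w = x * w * y" by (simp add: mult_ac)
  then show ?case using Cons by simp
qed simp

lemma foldl_mult_update:
  fixes x :: "'a::ab_semigroup_mult"
  assumes "i < length ws"
  shows "foldl (*) x (ws[i := y * z]) = foldl (*) x (ws[i := y]) * z"
  using assms
proof (induction ws arbitrary: x i)
  case (Cons w ws)
  show ?case
  proof (cases i)
    case 0
    then show ?thesis by (simp add: foldl_mult_right mult.assoc[symmetric])
  next
    case (Suc j)
    then show ?thesis using Cons by simp
  qed
qed simp

lemma foldl_mult_replicate: "0 < k \<Longrightarrow> foldl (*) x (replicate k g) = pos_power g k * x"
  for x :: "'a::ab_semigroup_mult"
proof (induction k)
  case (Suc k)
  have "foldl (*) x (replicate (Suc k) g) = foldl (*) x (replicate k g) * g"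
    by (simp add: foldl_mult_right)
  also have "\<dots> = pos_power g (Suc k) * x"
  proof (cases k)
    case 0
    then show ?thesis by (simp add: pos_power_def mult.commute)
  next
    case (Suc l)
    then show ?thesis using Suc.IH by (simp add: pos_power_def mult_ac)
  qed
  finally show ?case .
qed simp

context derivation
begin

lemma derivation_foldl_mult:
  "D (foldl (*) x ws) = foldl (*) (D x) ws + (\<Sum>i<length ws. foldl (*) x (ws[i := D (ws ! i)]))"
proof (induction ws rule: rev_induct)
  case (snoc w ws)
  have "(\<Sum>i<length ws. foldl (*) x ((ws @ [w])[i := D ((ws @ [w]) ! i)]))
      = (\<Sum>i<length ws. foldl (*) x (ws[i := D (ws ! i)])) * w"
    unfolding sum_distrib_right by (intro sum.cong refl) (simp add: list_update_append nth_append)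
  then show ?case
    by (simp add: Leibniz snoc distrib_right add.assoc)
qed simp

text \<open>By the Leibniz rule, differentiating the product for the shorter word yields one term
  with a further derivative on \<open>v\<close> and terms differentiating a letter; the brace
  recursion subtracts exactly the latter.\<close>

lemma brace_derivation: "brace (\<lambda>a b. D a * b) v ws = foldl (*) ((D ^^ length ws) v) ws"
proof (induction "length ws" arbitrary: ws)
  case (Suc n)
  obtain us w where ws: "ws = us @ [w]" and n: "length us = n"
    using Suc(2) by (metis length_Suc_conv_rev)
  let ?x = "(D ^^ n) v"
  have IH: "brace (\<lambda>a b. D a * b) v ts = foldl (*) ?x ts" if "length ts = n" for ts
    using Suc(1) that by metis
  have "brace (\<lambda>a b. D a * b) v ws = D (foldl (*) ?x us) * w
      - (\<Sum>i<length us. foldl (*) ?x (us[i := D (us ! i)])) * w"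
    using n by (simp add: ws IH foldl_mult_update sum_distrib_right)
  then show ?case
    using n by (simp add: ws derivation_foldl_mult distrib_right)
qed simp

end

theorem theorem8p1:
  fixes tri :: "'a::rat_vector \<Rightarrow> 'a \<Rightarrow> 'a" and f :: 'a
    and D :: "'b::rat_comm_algebra \<Rightarrow> 'b" and g :: 'b
  shows
    "(novikov_algebra tri \<longrightarrow>
        prelie_log tri f = fps_const (sym_of f) * fps_X + Abs_fps (\<lambda>n. if n < 2 then 0 else
          sym_of (\<Sum>i=1..n - 1. ((-1) ^ i / (of_nat i + 1)) *\<^sub>Q
            (\<Sum>ks\<in>compositions (n - 1) i. (1 / (\<Prod>k\<leftarrow>ks. fact k)) *\<^sub>Q
              foldl (\<lambda>x k. brace tri x (replicate k f)) f ks))))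
     \<and> (derivation D \<longrightarrow>
        prelie_log (\<lambda>a b. D a * b) g = fps_const (sym_of g) * fps_X + Abs_fps (\<lambda>n. if n < 2 then 0 else
          sym_of (\<Sum>i=1..n - 1. ((-1) ^ i / (of_nat i + 1)) *\<^sub>Q
            (\<Sum>ks\<in>compositions (n - 1) i. (1 / (\<Prod>k\<leftarrow>ks. fact k)) *\<^sub>Q
              foldl (\<lambda>x k. pos_power g k * (D ^^ k) x) g ks))))"
proof (intro conjI impI)
  assume "novikov_algebra tri"
  then show "prelie_log tri f = fps_const (sym_of f) * fps_X + Abs_fps (\<lambda>n. if n < 2 then 0 else
      sym_of (\<Sum>i=1..n - 1. ((-1) ^ i / (of_nat i + 1)) *\<^sub>Q
        (\<Sum>ks\<in>compositions (n - 1) i. (1 / (\<Prod>k\<leftarrow>ks. fact k)) *\<^sub>Q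
          foldl (\<lambda>x k. brace tri x (replicate k f)) f ks)))"
    by (rule novikov_algebra.prelie_log_compositions)
next
  assume D: "derivation D"
  \<comment> \<open>Parts of a composition are positive, so the junk value
    \<open>pos_power g 0\<close> never enters.\<close>
  have "foldl (\<lambda>x k. brace (\<lambda>a b. D a * b) x (replicate k g)) g ks
      = foldl (\<lambda>x k. pos_power g k * (D ^^ k) x) g ks" if "ks \<in> compositions m i" for ks m i
    using that
    by (intro foldl_cong refl)
      (auto simp: compositions_def derivation.brace_derivation[OF D] foldl_mult_replicate)
  then show "prelie_log (\<lambda>a b. D a * b) g = fps_const (sym_of g) * fps_X + Abs_fps (\<lambda>n. if n < 2 then 0 else
      sym_of (\<Sum>i=1..n - 1. ((-1) ^ i / (of_nat i + 1)) *\<^sub>Q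
        (\<Sum>ks\<in>compositions (n - 1) i. (1 / (\<Prod>k\<leftarrow>ks. fact k)) *\<^sub>Q
          foldl (\<lambda>x k. pos_power g k * (D ^^ k) x) g ks)))"
    unfolding novikov_algebra.prelie_log_compositions[OF derivation.novikov[OF D]]
    by (simp cong: sum.cong if_cong)
qed

end
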